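(* There is an $O(N\cdot 2^{O(\log W\log T)})$-time reduction from a BP-Satisfying-Pair instance with a branching program of length $T$ and width $W$ and two sets of $N$ strings to an OAPT instance with two sets of $N$ tensors of size $2^{O(\log W\log T)}$ (the OAPT instance is a yes-instance iff the BP-Satisfying-Pair instance is).
   Context: A (nondeterministic) branching program (BP) of length $T$ and width $W$ on Boolean inputs $x_1,\dots,x_n$ is a layered directed graph with $T$ layers of $W$ nodes; all nodes of layer $i<T$ are labelled by one variable $x_{f(i)}$; edges go between consecutive layers and are marked $0$ or $1$; it accepts $x$ iff there is a path from the first node of layer $1$ to the first node of layer $T$ using only edges whose mark equals the value of the variable labelling their starting node. BP-Satisfying-Pair: given a BP $P$ on $n$ inputs and $A,B\subseteq\{0,1\}^{n/2}$ of $N$ strings each, decide whether $P$ accepts the concatenation of some $a\in A$, $b\in B$. For even $t$, tensors $u,v\in\{0,1\}^{2\times\cdots\times 2}$ ($t$ factors, size $2^t$) indexed by $i\in\{0,1\}^t$ have alternating product $p_{\mathrm{alt}}(u,v)=\bigwedge_{i_1}\bigvee_{i_2}\bigwedge_{i_3}\cdots\bigvee_{i_t}(u_i\wedge v_i)$. OAPT: given two sets $A,B$ of $N$ such tensors, decide whether some $(a,b)\in A\times B$ has $p_{\mathrm{alt}}(a,b)=0$. *)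

theory Defs
  imports Complex_Main
begin

text \<open>Layers, the nodes of a layer and the input variables are numbered from 0.
  \<open>bp_edge P i u b v\<close> says that there is an edge marked \<open>b\<close> from node \<open>u\<close> of layer \<open>i\<close>
  to node \<open>v\<close> of layer \<open>i + 1\<close>; two nodes may be joined by edges of both marks.
  Values of \<open>bp_var\<close> and \<open>bp_edge\<close> outside the ranges given by \<open>bp_length\<close> and \<open>bp_width\<close>
  are never consulted.\<close>

record bp =
  bp_inputs :: nat
  bp_length :: nat
  bp_width :: nat
  bp_var :: "nat \<Rightarrow> nat"
  bp_edge :: "nat \<Rightarrow> nat \<Rightarrow> bool \<Rightarrow> nat \<Rightarrow> bool"

definition bp_wf :: "bp \<Rightarrow> bool" where
  "bp_wf P \<longleftrightarrow> 1 \<le> bp_length P \<and> 1 \<le> bp_width P \<and>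
     (\<forall>i. i + 1 < bp_length P \<longrightarrow> bp_var P i < bp_inputs P)"

definition bp_accepts :: "bp \<Rightarrow> bool list \<Rightarrow> bool" where
  "bp_accepts P x \<longleftrightarrow>
     (\<exists>q :: nat \<Rightarrow> nat.
        (\<forall>i < bp_length P. q i < bp_width P) \<and>
        q 0 = 0 \<and> q (bp_length P - 1) = 0 \<and>
        (\<forall>i. i + 1 < bp_length P \<longrightarrow> bp_edge P i (q i) (x ! bp_var P i) (q (i + 1))))"

text \<open>A "set of \<open>N\<close>" strings or tensors is a family indexed by \<open>{..<N}\<close>, i.e. a list of
  length \<open>N\<close>; repetitions are allowed on both sides of the reduction. (There are only
  \<open>2 ^ (2 ^ t)\<close> tensors with \<open>t\<close> factors, so \<open>N\<close> pairwise different ones need not exist.)\<close>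

record bpsp =
  bpsp_prog :: bp
  bpsp_left :: "bool list list"
  bpsp_right :: "bool list list"

definition bpsp_wf :: "bpsp \<Rightarrow> nat \<Rightarrow> bool" where
  "bpsp_wf I N \<longleftrightarrow> bp_wf (bpsp_prog I) \<and> even (bp_inputs (bpsp_prog I)) \<and>
     length (bpsp_left I) = N \<and> length (bpsp_right I) = N \<and>
     (\<forall>a \<in> set (bpsp_left I) \<union> set (bpsp_right I). length a = bp_inputs (bpsp_prog I) div 2)"

definition bpsp_yes :: "bpsp \<Rightarrow> bool" where
  "bpsp_yes I \<longleftrightarrow>
     (\<exists>a \<in> set (bpsp_left I). \<exists>b \<in> set (bpsp_right I). bp_accepts (bpsp_prog I) (a @ b))"

text \<open>A tensor with \<open>t\<close> factors is a function on index lists; only its values on the lists of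
  length \<open>t\<close> matter.\<close>

type_synonym tensor = "bool list \<Rightarrow> bool"

fun alternate :: "bool \<Rightarrow> nat \<Rightarrow> tensor \<Rightarrow> bool" where
  "alternate c 0 g = g []"
| "alternate True (Suc t) g = (\<forall>i. alternate False t (\<lambda>is. g (i # is)))"
| "alternate False (Suc t) g = (\<exists>i. alternate True t (\<lambda>is. g (i # is)))"

definition p_alt :: "nat \<Rightarrow> tensor \<Rightarrow> tensor \<Rightarrow> bool" where
  "p_alt t u v = alternate True t (\<lambda>i. u i \<and> v i)"

record oapt =
  oapt_factors :: nat
  oapt_left :: "tensor list"
  oapt_right :: "tensor list"

definition oapt_wf :: "oapt \<Rightarrow> nat \<Rightarrow> bool" where
  "oapt_wf J N \<longleftrightarrow> 0 < oapt_factors J \<and> even (oapt_factors J) \<and>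
     length (oapt_left J) = N \<and> length (oapt_right J) = N"

definition oapt_yes :: "oapt \<Rightarrow> bool" where
  "oapt_yes J \<longleftrightarrow>
     (\<exists>a \<in> set (oapt_left J). \<exists>b \<in> set (oapt_right J). \<not> p_alt (oapt_factors J) a b)"

text \<open>Running time is measured on a word RAM: programs are structured commands over registers
  and a random-access memory, both holding words of \<open>w\<close> bits. Every assignment, memory access
  and test takes one step. A computation that would produce a value of \<open>2 ^ w\<close> or more gets
  stuck, i.e. has no execution.\<close>

datatype arith = Add | Sub | Mul | Div

fun arith_val :: "arith \<Rightarrow> nat \<Rightarrow> nat \<Rightarrow> nat" where
  "arith_val Add x y = x + y"
| "arith_val Sub x y = x - y"
| "arith_val Mul x y = x * y"
| "arith_val Div x y = x div y"

datatype com =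
    Const nat nat           \<comment> \<open>\<open>r := k\<close>\<close>
  | Arith arith nat nat nat \<comment> \<open>\<open>r := r1 op r2\<close>\<close>
  | Load nat nat            \<comment> \<open>\<open>r := memory[r1]\<close>\<close>
  | Store nat nat           \<comment> \<open>\<open>memory[r1] := r2\<close>\<close>
  | Seq com com
  | IfLess nat nat com com
  | WhileLess nat nat com

type_synonym state = "(nat \<Rightarrow> nat) \<times> (nat \<Rightarrow> nat)"

inductive exec :: "nat \<Rightarrow> com \<Rightarrow> state \<Rightarrow> nat \<Rightarrow> state \<Rightarrow> bool" for w :: nat where
  Const: "k < 2 ^ w \<Longrightarrow> exec w (Const r k) (R, M) 1 (R(r := k), M)"
| Arith: "arith_val f (R r1) (R r2) < 2 ^ w \<Longrightarrow>
    exec w (Arith f r r1 r2) (R, M) 1 (R(r := arith_val f (R r1) (R r2)), M)"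
| Load: "M (R r1) < 2 ^ w \<Longrightarrow> exec w (Load r r1) (R, M) 1 (R(r := M (R r1)), M)"
| Store: "exec w (Store r1 r2) (R, M) 1 (R, M(R r1 := R r2))"
| Seq: "exec w p s k s' \<Longrightarrow> exec w q s' l s'' \<Longrightarrow> exec w (Seq p q) s (k + l) s''"
| IfTrue: "R r1 < R r2 \<Longrightarrow> exec w p (R, M) k s' \<Longrightarrow>
    exec w (IfLess r1 r2 p q) (R, M) (1 + k) s'"
| IfFalse: "\<not> R r1 < R r2 \<Longrightarrow> exec w q (R, M) k s' \<Longrightarrow>
    exec w (IfLess r1 r2 p q) (R, M) (1 + k) s'"
| WhileFalse: "\<not> R r1 < R r2 \<Longrightarrow> exec w (WhileLess r1 r2 p) (R, M) 1 (R, M)"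
| WhileTrue: "R r1 < R r2 \<Longrightarrow> exec w p (R, M) k s' \<Longrightarrow>
    exec w (WhileLess r1 r2 p) s' l s'' \<Longrightarrow>
    exec w (WhileLess r1 r2 p) (R, M) (1 + k + l) s''"

definition init_state :: "nat list \<Rightarrow> state" where
  "init_state xs = ((\<lambda>_. 0), (\<lambda>j. if j < length xs then xs ! j else 0))"

text \<open>The input occupies the memory from address 0 on; the output is read off the final memory,
  from the address held in register 0 on.\<close>

definition computes_in :: "nat \<Rightarrow> com \<Rightarrow> nat list \<Rightarrow> nat list \<Rightarrow> nat \<Rightarrow> bool" where
  "computes_in w p xs ys k \<longleftrightarrow>
     (\<exists>R M. exec w p (init_state xs) k (R, M) \<and>
        (\<forall>j < length ys. R 0 + j < 2 ^ w \<and> M (R 0 + j) = ys ! j))"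

inductive_cases exec_elims:
  "exec w (Const r k) s l s'"
  "exec w (Arith f r r1 r2) s l s'"
  "exec w (Load r r1) s l s'"
  "exec w (Store r1 r2) s l s'"
  "exec w (Seq p q) s l s'"
  "exec w (IfLess r1 r2 p q) s l s'"
  "exec w (WhileLess r1 r2 p) s l s'"

lemma exec_deterministic:
  "exec w p s k s' \<Longrightarrow> exec w p s l s'' \<Longrightarrow> l = k \<and> s'' = s'"
proof (induction arbitrary: l s'' rule: exec.induct)
  case (Const k r R M)
  from Const.prems show ?case by (rule exec_elims(1)) simp
next
  case (Arith f R r1 r2 r M)
  from Arith.prems show ?case by (rule exec_elims(2)) simp
next
  case (Load M R r1 r)
  from Load.prems show ?case by (rule exec_elims(3)) simp
next
  case (Store r1 r2 R M)
  from Store.prems show ?case by (rule exec_elims(4)) simp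
next
  case (Seq p s k s1 q m s2)
  from Seq.prems show ?case by (rule exec_elims(5)) (metis Seq.IH)
next
  case (IfTrue R r1 r2 p M k s1 q)
  from IfTrue.prems show ?case
    by (rule exec_elims(6)) (use IfTrue.hyps in \<open>auto dest: IfTrue.IH\<close>)
next
  case (IfFalse R r1 r2 q M k s1 p)
  from IfFalse.prems show ?case
    by (rule exec_elims(6)) (use IfFalse.hyps in \<open>auto dest: IfFalse.IH\<close>)
next
  case (WhileFalse R r1 r2 p M)
  from WhileFalse.prems show ?case
    by (rule exec_elims(7)) (use WhileFalse.hyps in simp_all)
next
  case (WhileTrue R r1 r2 p M k s1 m s2)
  from WhileTrue.prems WhileTrue.hyps(1) obtain k' s1' m' where
    "l = 1 + k' + m'" "exec w p (R, M) k' s1'" "exec w (WhileLess r1 r2 p) s1' m' s''"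
    by - (erule exec_elims(7), simp_all)
  with WhileTrue.IH show ?case by metis
qed

definition encode_bpsp :: "bpsp \<Rightarrow> nat list" where
  "encode_bpsp I =
     (let P = bpsp_prog I; T = bp_length P; W = bp_width P in
      [length (bpsp_left I), bp_inputs P, T, W]
      @ map (bp_var P) [0..<T - 1]
      @ [of_bool (bp_edge P i u b v).
           i \<leftarrow> [0..<T - 1], u \<leftarrow> [0..<W], v \<leftarrow> [0..<W], b \<leftarrow> [False, True]]
      @ map of_bool (concat (bpsp_left I))
      @ map of_bool (concat (bpsp_right I)))"

text \<open>The entries of a tensor are listed in lexicographic order of their index.\<close>

definition encode_tensor :: "nat \<Rightarrow> tensor \<Rightarrow> nat list" where
  "encode_tensor t u = map (\<lambda>i. of_bool (u i)) (product_lists (replicate t [False, True]))"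

definition encode_oapt :: "oapt \<Rightarrow> nat list" where
  "encode_oapt J =
     [length (oapt_left J), oapt_factors J]
     @ concat (map (encode_tensor (oapt_factors J)) (oapt_left J))
     @ concat (map (encode_tensor (oapt_factors J)) (oapt_right J))"

end

theory Submission
  imports Defs
begin

text \<open>The OAPT value is refuted by a two-player game in the style of Savitch's theorem. A path through
  the branching program is claimed by announcing its middle node, bit by bit, with the existential
  choices; the opponent selects the half to be examined next. There are \<open>clog T\<close> levels of
  \<open>clog W\<close> announced bits each, so the alternation has \<open>2 * clog T * clog W\<close> factors, and
  every leaf of the game names a single potential edge. Which string owns the variable read by that
  edge is known, so the tensor of that string alone can refute the leaf: a leaf is winning iff one
  of the two tensors is 0 there. The tensors are tabulated by decoding every index in
  \<open>O(log W * log T)\<close> steps; the length of the strings does not matter since only one of their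
  bits is read per entry.\<close>

section \<open>Binary logarithms and indices\<close>

text \<open>The shape of the game is dictated by what a leaf can express. That one of two tensors is
  0 is a disjunction of a property of \<open>a\<close> and a property of \<open>b\<close>, each
  tabulated without sight of the other string. Acceptance along a whole path mixes variables of both
  strings and is in general no such disjunction, whereas a single edge reads one variable and is. So
  the claim has to shrink to one edge, and halving the path achieves this in \<open>clog T\<close>
  levels rather than \<open>T\<close>. The second constraint is strict alternation with one bit per
  quantifier. Negating the alternating product gives exists-forall pairs, so every announced bit is
  followed by an opponent's bit even while a midpoint is incomplete; these idle bits account for the
  2 in \<open>2 * (K * L)\<close>. The constants come from there: rounding two logarithms up and
  doubling gives the size exponent 8, and paying the decoding time with one more factor
  \<open>2 ^ t\<close> gives the time exponent 16.\<close>

definition clog :: "nat \<Rightarrow> nat" where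
  "clog n = (LEAST l. n \<le> 2 ^ l)"

lemma le_two_power_clog: "n \<le> 2 ^ clog n"
  unfolding clog_def by (rule LeastI[of _ n]) (simp add: less_imp_le)

text \<open>Leastness keeps the guard of a doubling loop true for exactly \<open>clog n\<close>
  iterations, with \<open>le_two_power_clog\<close> ending it; the program obtains its exponents in
  this way.\<close>

lemma two_power_less_if_less_clog: "l < clog n \<Longrightarrow> 2 ^ l < n"
  unfolding clog_def by (drule not_less_Least) simp

lemma clog_pos: "2 \<le> n \<Longrightarrow> 0 < clog n"
  using le_two_power_clog[of n] by (cases "clog n") auto

lemma two_power_clog_less: "1 \<le> n \<Longrightarrow> 2 ^ clog n < 2 * n"
  using two_power_less_if_less_clog[of "clog n - 1" n] by (cases "clog n") auto

text \<open>Rounding up adds at most 1, which is at most \<open>log 2 n\<close> once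
  \<open>2 \<le> n\<close>. A purely multiplicative bound is wanted because the final exponents are
  multiples of a product of logarithms.\<close>

lemma clog_le_log:
  assumes "2 \<le> n"
  shows "real (clog n) \<le> 2 * log 2 (real n)"
proof -
  have "real (2 ^ clog n) < real (2 * n)"
    using two_power_clog_less[of n] assms by (simp only: of_nat_less_iff)
  then have "2 ^ clog n < 2 * real n" by simp
  then have "log 2 (2 ^ clog n) \<le> log 2 (2 * real n)"
    using assms by (subst log_le_cancel_iff) auto
  then have "real (clog n) \<le> 1 + log 2 (real n)"
    using assms by (simp add: log_mult)
  moreover have "1 \<le> log 2 (real n)"
    using assms by simp
  ultimately show ?thesis by simp
qed

text \<open>The most significant bit comes first, so that numerical order agrees with the
  lexicographic order of \<open>product_lists\<close>.\<close>

fun bits_val :: "bool list \<Rightarrow> nat" where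
  "bits_val [] = 0"
| "bits_val (b # bs) = of_bool b * 2 ^ length bs + bits_val bs"

lemma bits_val_less: "bits_val bs < 2 ^ length bs"
  by (induction bs) auto

lemma length_product_lists_bool:
  "bs \<in> set (product_lists (replicate t [False, True])) \<Longrightarrow> length bs = t"
  using in_set_product_lists_length by fastforce

text \<open>This makes the rank of an entry carry its index: the program can recover the index bits
  of an entry from its position by division.\<close>

lemma map_bits_val_product_lists:
  "map bits_val (product_lists (replicate t [False, True])) = [0..<2 ^ t]"
proof (induction t)
  case (Suc t)
  let ?L = "product_lists (replicate t [False, True])"
  have "map (bits_val \<circ> (#) True) ?L = map (\<lambda>bs. 2 ^ t + bits_val bs) ?L"
    by (rule map_cong) (auto dest: length_product_lists_bool)
  also have "\<dots> = map (\<lambda>i. i + 2 ^ t) (map bits_val ?L)"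
    by (simp add: add.commute)
  also have "\<dots> = [2 ^ t..<2 ^ Suc t]"
    by (simp only: Suc.IH map_add_upt) (simp add: mult_2)
  finally have 1: "map (bits_val \<circ> (#) True) ?L = [2 ^ t..<2 ^ Suc t]" .
  have "map (bits_val \<circ> (#) False) ?L = map bits_val ?L"
    by simp
  then have "map (bits_val \<circ> (#) False) ?L = [0..<2 ^ t]"
    using Suc.IH by simp
  with 1 show ?case
    using upt_add_eq_append[of 0 "2 ^ t" "2 ^ t"] by (simp add: mult_2)
qed simp

lemma length_product_lists_bools: "length (product_lists (replicate t [False, True])) = 2 ^ t"
  using arg_cong[OF map_bits_val_product_lists[of t], of length] by simp

lemma product_lists_nth:
  assumes "i < 2 ^ t"
  shows "length (product_lists (replicate t [False, True]) ! i) = t"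
    and "bits_val (product_lists (replicate t [False, True]) ! i) = i"
proof -
  show "length (product_lists (replicate t [False, True]) ! i) = t"
    using assms by (intro length_product_lists_bool nth_mem) (simp add: length_product_lists_bools)
  show "bits_val (product_lists (replicate t [False, True]) ! i) = i"
    using assms arg_cong[OF map_bits_val_product_lists[of t], of "\<lambda>xs. xs ! i"]
    by (simp add: length_product_lists_bools)
qed

lemma length_concat_map_uniform:
  "(\<And>x. x \<in> set xs \<Longrightarrow> length (f x) = k) \<Longrightarrow> length (concat (map f xs)) = length xs * k"
  by (induction xs) auto

lemma nth_concat_map_uniform:
  assumes "\<And>x. x \<in> set xs \<Longrightarrow> length (f x) = k" "i < length xs" "j < k"
  shows "concat (map f xs) ! (i * k + j) = f (xs ! i) ! j"
  using assms
proof (induction xs arbitrary: i)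
  case (Cons x xs)
  then show ?case
    by (cases i) (auto simp: nth_append)
qed simp

section \<open>The reachability game\<close>

text \<open>A position of the game is \<open>(m, u, v, s)\<close>: the existential player claims a path from \<open>u\<close> to
  \<open>v\<close> in the segment numbered \<open>s\<close> of the current dyadic subdivision of the layers, and \<open>m\<close> holds,
  below a leading 1, the bits of the midpoint announced so far. When \<open>Q = 2 ^ L\<close> is reached the
  midpoint is complete and the universal bit of that round selects a half; the universal bits of
  the other rounds are ignored.\<close>

type_synonym position = "nat \<times> nat \<times> nat \<times> nat"

fun advance :: "nat \<Rightarrow> bool \<Rightarrow> bool \<Rightarrow> position \<Rightarrow> position" where
  "advance Q e h (m, u, v, s) =
     (let m' = 2 * m + of_bool e in
      if m' < Q then (m', u, v, s)
      else if h then (1, m' - Q, v, 2 * s + 1)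
      else (1, u, m' - Q, 2 * s))"

fun walk :: "nat \<Rightarrow> position \<Rightarrow> bool list \<Rightarrow> position" where
  "walk Q p (e # h # bs) = walk Q (advance Q e h p) bs"
| "walk Q p bs = p"

fun wins :: "nat \<Rightarrow> (position \<Rightarrow> bool) \<Rightarrow> nat \<Rightarrow> position \<Rightarrow> bool" where
  "wins Q A 0 p = A p"
| "wins Q A (Suc k) p = (\<exists>e. \<forall>h. wins Q A k (advance Q e h p))"

text \<open>Negation swaps the quantifiers: the universal first bit of each pair becomes the
  announced bit, the existential second bit the opponent's choice.\<close>

lemma alternate_walk_iff_wins:
  "alternate True (2 * k) (\<lambda>bs. \<not> A (walk Q p bs)) \<longleftrightarrow> \<not> wins Q A k p"
  by (induction k arbitrary: p) auto

text \<open>Generalises \<open>wins_midpoint\<close> to a partly announced midpoint so that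
  induction applies. The bounds on \<open>m\<close> say that it has \<open>L - r\<close> bits below
  its leading 1; the missing \<open>r\<close> bits are \<open>x\<close>, and subtracting
  \<open>2 ^ L\<close> strips the leading 1.\<close>

lemma wins_announce:
  assumes "0 < r" "r \<le> L" "2 ^ (L - r) \<le> m" "m < 2 * 2 ^ (L - r)"
  shows "wins (2 ^ L) A (r + k) (m, u, v, s) \<longleftrightarrow>
    (\<exists>x < 2 ^ r. wins (2 ^ L) A k (1, u, m * 2 ^ r + x - 2 ^ L, 2 * s) \<and>
                 wins (2 ^ L) A k (1, m * 2 ^ r + x - 2 ^ L, v, 2 * s + 1))"
  using assms
proof (induction r arbitrary: m)
  case (Suc r)
  show ?case
  \<comment> \<open>With one bit missing, \<open>advance\<close> completes the midpoint and the
    opponent's bit selects a half; with more missing, that bit has no effect.\<close>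
  proof (cases "r = 0")
    case True
    with Suc.prems have "2 ^ L \<le> 2 * m"
      by (cases L) auto
    then have *: "\<not> 2 * m + of_bool e < 2 ^ L" for e
      by simp
    have "(\<exists>x < 2 ^ Suc r. Q x) \<longleftrightarrow> Q 0 \<or> Q 1" for Q :: "nat \<Rightarrow> bool"
      using True by (auto simp: less_2_cases_iff)
    with True show ?thesis
      using *[of True] *[of False] by (auto simp: all_bool_eq ex_bool_eq Let_def mult.commute)
  next
    case False
    define c where "c = (2::nat) ^ (L - Suc r)"
    have c: "2 ^ (L - r) = 2 * c"
      using Suc.prems unfolding c_def by (metis Suc_diff_le diff_Suc_Suc power_Suc)
    have "2 ^ r * (2 * c) = (2::nat) ^ L"
      unfolding c[symmetric] using Suc.prems by (simp flip: power_add)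
    moreover have "2 \<le> (2::nat) ^ r"
      using False by (cases r) auto
    moreover have m: "c \<le> m" "m < 2 * c"
      using Suc.prems by (simp_all add: c_def)
    \<comment> \<open>At least two bits are missing, so \<open>2 * m + 1 < 4 * c\<close> and the
      threshold is not reached in this round.\<close>
    ultimately have "4 * c \<le> 2 ^ L"
      by (metis mult_le_mono1 mult.assoc mult_2_right numeral_Bit0 mult.commute)
    with m have *: "2 * m + of_bool e < 2 ^ L" for e
      by (cases e) auto
    have IH: "wins (2 ^ L) A (r + k) (2 * m + of_bool e, u, v, s) \<longleftrightarrow>
      (\<exists>x < 2 ^ r. wins (2 ^ L) A k (1, u, (2 * m + of_bool e) * 2 ^ r + x - 2 ^ L, 2 * s) \<and>
                 wins (2 ^ L) A k (1, (2 * m + of_bool e) * 2 ^ r + x - 2 ^ L, v, 2 * s + 1))" for e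
      using False Suc.prems m by (intro Suc.IH) (auto simp: c)
    have split: "(\<exists>x < 2 ^ Suc r. Q x) \<longleftrightarrow> (\<exists>e. \<exists>x < 2 ^ r. Q (of_bool e * 2 ^ r + x))"
      for Q :: "nat \<Rightarrow> bool"
    proof
      assume "\<exists>x < 2 ^ Suc r. Q x"
      then obtain x where x: "x < 2 ^ Suc r" "Q x" by blast
      show "\<exists>e. \<exists>x < 2 ^ r. Q (of_bool e * 2 ^ r + x)"
      proof (cases "x < 2 ^ r")
        case True
        with x show ?thesis by (intro exI[of _ False]) auto
      next
        case False
        with x show ?thesis
          by (intro exI[of _ True] exI[of _ "x - 2 ^ r"]) auto
      qed
    next
      assume "\<exists>e. \<exists>x < 2 ^ r. Q (of_bool e * 2 ^ r + x)"
      then obtain e x where "x < 2 ^ r" "Q (of_bool e * 2 ^ r + x)" by blast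
      moreover from this have "of_bool e * 2 ^ r + x < 2 ^ Suc r"
        by (cases e) auto
      ultimately show "\<exists>x < 2 ^ Suc r. Q x" by blast
    qed
    have "wins (2 ^ L) A (Suc r + k) (m, u, v, s) \<longleftrightarrow>
      (\<exists>e. wins (2 ^ L) A (r + k) (2 * m + of_bool e, u, v, s))"
      using * by (simp add: Let_def)
    then show ?thesis
      unfolding IH split by (simp add: algebra_simps)
  qed
qed simp

lemma wins_midpoint:
  assumes "0 < L"
  shows "wins (2 ^ L) A (L + k) (1, u, v, s) \<longleftrightarrow>
    (\<exists>x < 2 ^ L. wins (2 ^ L) A k (1, u, x, 2 * s) \<and> wins (2 ^ L) A k (1, x, v, 2 * s + 1))"
  using wins_announce[of L L 1 A k u v s] assms by simp

text \<open>The midpoint is announced before the half is chosen, so the strategies for both halves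
  share the node \<open>x\<close> and their paths glue there. Segment \<open>s\<close> at height
  \<open>j\<close> consists of the edges from number \<open>s * 2 ^ j\<close> on, a numbering that
  halving into \<open>2 * s\<close> and \<open>2 * s + 1\<close> preserves. Nodes range below
  \<open>2 ^ L\<close>; excluding those from \<open>W\<close> on is left to the leaf
  predicate.\<close>

lemma wins_iff_path:
  assumes "0 < L" "u < 2 ^ L" "v < 2 ^ L"
  shows "wins (2 ^ L) A (j * L) (1, u, v, s) \<longleftrightarrow>
    (\<exists>q :: nat \<Rightarrow> nat. (\<forall>i \<le> 2 ^ j. q i < 2 ^ L) \<and> q 0 = u \<and> q (2 ^ j) = v \<and>
       (\<forall>i < 2 ^ j. A (1, q i, q (i + 1), s * 2 ^ j + i)))"
  using assms(2,3)
proof (induction j arbitrary: u v s)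
  case 0
  show ?case
  proof
    assume "wins (2 ^ L) A (0 * L) (1, u, v, s)"
    then show "\<exists>q :: nat \<Rightarrow> nat. (\<forall>i \<le> 2 ^ 0. q i < 2 ^ L) \<and> q 0 = u \<and> q (2 ^ 0) = v \<and>
       (\<forall>i < 2 ^ 0. A (1, q i, q (i + 1), s * 2 ^ 0 + i))"
      using 0 by (intro exI[of _ "\<lambda>i. if i = 0 then u else v"]) auto
  qed auto
next
  case (Suc j)
  let ?n = "(2::nat) ^ j"
  have "wins (2 ^ L) A (Suc j * L) (1, u, v, s) \<longleftrightarrow>
    (\<exists>x < 2 ^ L. wins (2 ^ L) A (j * L) (1, u, x, 2 * s) \<and>
       wins (2 ^ L) A (j * L) (1, x, v, 2 * s + 1))"
    using wins_midpoint[OF assms(1)] by simp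
  also have "\<dots> \<longleftrightarrow> (\<exists>q :: nat \<Rightarrow> nat. (\<forall>i \<le> 2 ^ Suc j. q i < 2 ^ L) \<and> q 0 = u \<and> q (2 ^ Suc j) = v \<and>
       (\<forall>i < 2 ^ Suc j. A (1, q i, q (i + 1), s * 2 ^ Suc j + i)))"
    (is "?L \<longleftrightarrow> ?R")
  proof
    assume ?L
    then obtain x where x: "x < 2 ^ L" "wins (2 ^ L) A (j * L) (1, u, x, 2 * s)"
      "wins (2 ^ L) A (j * L) (1, x, v, 2 * s + 1)" by blast
    from x(2) obtain q1 where q1: "\<forall>i \<le> ?n. q1 i < 2 ^ L" "q1 0 = u" "q1 ?n = x"
      "\<forall>i < ?n. A (1, q1 i, q1 (i + 1), 2 * s * ?n + i)"
      using Suc.IH[OF Suc.prems(1) x(1)] by auto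
    from x(3) obtain q2 where q2: "\<forall>i \<le> ?n. q2 i < 2 ^ L" "q2 0 = x" "q2 ?n = v"
      "\<forall>i < ?n. A (1, q2 i, q2 (i + 1), (2 * s + 1) * ?n + i)"
      using Suc.IH[OF x(1) Suc.prems(2)] by auto
    define q where "q i = (if i \<le> ?n then q1 i else q2 (i - ?n))" for i
    have "A (1, q i, q (i + 1), s * 2 ^ Suc j + i)" if "i < 2 ^ Suc j" for i
    proof (cases "i < ?n")
      case True
      then show ?thesis using q1(4) by (simp add: q_def algebra_simps)
    next
      case False
      then have "q i = q2 (i - ?n)" "q (i + 1) = q2 (i - ?n + 1)"
        using q1 q2 by (auto simp: q_def Suc_diff_le)
      moreover have "A (1, q2 (i - ?n), q2 (i - ?n + 1), (2 * s + 1) * ?n + (i - ?n))"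
        using False that by (intro q2(4)[rule_format]) auto
      moreover have "(2 * s + 1) * ?n + (i - ?n) = s * 2 ^ Suc j + i"
        using False by (simp add: algebra_simps)
      ultimately show ?thesis by (simp only:)
    qed
    moreover have "\<forall>i \<le> 2 ^ Suc j. q i < 2 ^ L" "q 0 = u" "q (2 ^ Suc j) = v"
      using q1 q2 by (auto simp: q_def)
    ultimately show ?R by blast
  next
    assume ?R
    then obtain q where q: "\<forall>i \<le> 2 ^ Suc j. q i < 2 ^ L" "q 0 = u" "q (2 ^ Suc j) = v"
       "\<forall>i < 2 ^ Suc j. A (1, q i, q (i + 1), s * 2 ^ Suc j + i)" by blast
    have x: "q ?n < 2 ^ L" using q(1) by simp
    have "A (1, q i, q (i + 1), 2 * s * ?n + i)" if "i < ?n" for i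
      using q(4)[rule_format, of i] that by (simp add: algebra_simps)
    then have "wins (2 ^ L) A (j * L) (1, u, q ?n, 2 * s)"
      unfolding Suc.IH[OF Suc.prems(1) x] using q by (intro exI[of _ q]) auto
    moreover have "A (1, q (i + ?n), q (i + 1 + ?n), (2 * s + 1) * ?n + i)" if "i < ?n" for i
      using q(4)[rule_format, of "i + ?n"] that by (simp add: algebra_simps)
    then have "wins (2 ^ L) A (j * L) (1, q ?n, v, 2 * s + 1)"
      unfolding Suc.IH[OF x Suc.prems(2)] using q
      by (intro exI[of _ "\<lambda>i. q (i + ?n)"]) (auto simp: mult_2)
    ultimately show ?L using x by blast
  qed
  finally show ?case .
qed

section \<open>The OAPT instance of a branching program and its correctness\<close>

locale bpsp_instance =
  fixes I :: bpsp and N :: nat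
  assumes wf: "bpsp_wf I N"
    and N_pos: "1 \<le> N"
    and length_ge: "2 \<le> bp_length (bpsp_prog I)"
    and width_ge: "2 \<le> bp_width (bpsp_prog I)"
begin

abbreviation "T \<equiv> bp_length (bpsp_prog I)"
abbreviation "W \<equiv> bp_width (bpsp_prog I)"
abbreviation "var \<equiv> bp_var (bpsp_prog I)"
abbreviation "edge \<equiv> bp_edge (bpsp_prog I)"
abbreviation "h \<equiv> bp_inputs (bpsp_prog I) div 2"
abbreviation "strings \<equiv> bpsp_left I @ bpsp_right I"
abbreviation "L \<equiv> clog W"
abbreviation "K \<equiv> clog T"
abbreviation "t \<equiv> 2 * (K * L)"

lemma inputs_eq: "bp_inputs (bpsp_prog I) = 2 * h"
  using wf by (simp add: bpsp_wf_def)

lemma length_left: "length (bpsp_left I) = N"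
  and length_right: "length (bpsp_right I) = N"
  using wf by (simp_all add: bpsp_wf_def)

lemma length_string: "a \<in> set strings \<Longrightarrow> length a = h"
  using wf by (auto simp: bpsp_wf_def)

lemma length_strings_nth: "j < 2 * N \<Longrightarrow> length (strings ! j) = h"
  by (intro length_string nth_mem) (simp add: length_left length_right)

lemma var_less: "s + 1 < T \<Longrightarrow> var s < 2 * h"
  using wf inputs_eq by (simp add: bpsp_wf_def bp_wf_def)

text \<open>Both families are numbered consecutively, left strings first, so that one definition of
  tensors serves both sides; this is the first variable belonging to string
  \<open>j\<close>.\<close>

definition offset :: "nat \<Rightarrow> nat" where
  "offset j = (if j < N then 0 else h)"

text \<open>The owner \<open>j\<close> of the queried variable vouches for the edge. Layers are padded to a power of
  two; the padding demands node 0, which forces the path to end in node 0 of the last layer.\<close>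

fun good :: "nat \<Rightarrow> position \<Rightarrow> bool" where
  "good j (m, u, v, s) \<longleftrightarrow>
     (if s + 1 < T
      then offset j \<le> var s \<and> var s < offset j + h \<and> u < W \<and> v < W \<and>
        edge s u (strings ! j ! (var s - offset j)) v
      else u = 0)"

definition tensor_of :: "nat \<Rightarrow> tensor" where
  "tensor_of j bs \<longleftrightarrow> \<not> good j (walk (2 ^ L) (1, 0, 0, 0) bs)"

definition target :: oapt where
  "target = \<lparr>oapt_factors = t, oapt_left = map tensor_of [0..<N],
     oapt_right = map tensor_of [N..<2 * N]\<rparr>"

lemma oapt_wf_target: "oapt_wf target N"
  using clog_pos[OF length_ge] clog_pos[OF width_ge] by (simp add: oapt_wf_def target_def)

text \<open>The variables of the two strings partition the range below \<open>2 * h\<close>, so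
  exactly one of them owns \<open>var s\<close>, and \<open>good\<close> is false for the other. On
  padding edges both agree.\<close>

lemma good_pair_iff:
  assumes "j < N" "N \<le> k" "k < 2 * N"
  shows "good j (m, u, v, s) \<or> good k (m, u, v, s) \<longleftrightarrow>
    (if s + 1 < T then u < W \<and> v < W \<and> edge s u ((strings ! j @ strings ! k) ! var s) v else u = 0)"
proof -
  have "(strings ! j @ strings ! k) ! var s =
    (if var s < h then strings ! j ! var s else strings ! k ! (var s - h))"
    using length_strings_nth[of j] assms by (simp only: nth_append[of "strings ! j"])
  then show ?thesis
    using assms var_less[of s] by (auto simp: offset_def)
qed

lemma wins_iff_accepts:
  fixes x :: "bool list"
  assumes A: "\<And>m u v s. A (m, u, v, s) \<longleftrightarrow>
    (if s + 1 < T then u < W \<and> v < W \<and> edge s u (x ! var s) v else u = 0)"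
  shows "wins (2 ^ L) A (K * L) (1, 0, 0, 0) \<longleftrightarrow> bp_accepts (bpsp_prog I) x"
proof -
  have T: "T \<le> 2 ^ K" and W: "W \<le> 2 ^ L"
    by (rule le_two_power_clog)+
  have "wins (2 ^ L) A (K * L) (1, 0, 0, 0) \<longleftrightarrow>
    (\<exists>q :: nat \<Rightarrow> nat. (\<forall>i \<le> 2 ^ K. q i < 2 ^ L) \<and> q 0 = 0 \<and> q (2 ^ K) = 0 \<and>
       (\<forall>i < 2 ^ K. A (1, q i, q (i + 1), i)))"
    using wins_iff_path[of L 0 0 A K 0] clog_pos[OF width_ge] by simp
  also have "\<dots> \<longleftrightarrow> bp_accepts (bpsp_prog I) x"
  proof
    assume "\<exists>q :: nat \<Rightarrow> nat. (\<forall>i \<le> 2 ^ K. q i < 2 ^ L) \<and> q 0 = 0 \<and> q (2 ^ K) = 0 \<and>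
       (\<forall>i < 2 ^ K. A (1, q i, q (i + 1), i))"
    then obtain q where q: "q 0 = 0" "\<And>i. i < 2 ^ K \<Longrightarrow> A (1, q i, q (i + 1), i)"
      by blast
    have edges: "q i < W \<and> edge i (q i) (x ! var i) (q (i + 1))" if "i + 1 < T" for i
      using q(2)[of i] that T unfolding A by simp
    \<comment> \<open>Edge number \<open>T - 1\<close> is the first padding edge. It exists even if
      \<open>T\<close> is a power of two, since the game has \<open>2 ^ K\<close> edges while the
      program has only \<open>T - 1\<close> steps.\<close>
    have last: "q (T - 1) = 0"
      using q(2)[of "T - 1"] T length_ge unfolding A by simp
    have "q i < W" if "i < T" for i
      using edges[of i] last that width_ge by (cases "i + 1 < T") (auto simp: not_less le_Suc_eq dest!: Suc_leI)
    then show "bp_accepts (bpsp_prog I) x"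
      unfolding bp_accepts_def using q(1) edges last by blast
  next
    assume "bp_accepts (bpsp_prog I) x"
    then obtain q where q: "\<And>i. i < T \<Longrightarrow> q i < W" "q 0 = 0" "q (T - 1) = 0"
      "\<And>i. i + 1 < T \<Longrightarrow> edge i (q i) (x ! var i) (q (i + 1))"
      unfolding bp_accepts_def by blast
    \<comment> \<open>The accepting path already ends in node 0 and stays there through the
      padding.\<close>
    define r where "r i = (if i < T then q i else 0)" for i
    have zero: "r i = 0" if "T - 1 \<le> i" for i
      using that q(3) by (cases "i = T - 1") (auto simp: r_def)
    have "r i < W" for i
      using q(1) width_ge by (auto simp: r_def)
    then have "r i < 2 ^ L" for i
      using W order_less_le_trans by blast
    moreover have "A (1, r i, r (i + 1), i)" for i
      using q(1)[of i] q(1)[of "i + 1"] q(4)[of i] zero[of i] unfolding A by (auto simp: r_def)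
    moreover have "r 0 = 0" "r (2 ^ K) = 0"
      using q(2) T by (auto simp: r_def)
    ultimately show "\<exists>q :: nat \<Rightarrow> nat. (\<forall>i \<le> 2 ^ K. q i < 2 ^ L) \<and> q 0 = 0 \<and> q (2 ^ K) = 0 \<and>
       (\<forall>i < 2 ^ K. A (1, q i, q (i + 1), i))"
      by blast
  qed
  finally show ?thesis .
qed

lemma p_alt_tensor_of:
  assumes "j < N" "N \<le> k" "k < 2 * N"
  shows "\<not> p_alt t (tensor_of j) (tensor_of k) \<longleftrightarrow>
    bp_accepts (bpsp_prog I) (strings ! j @ strings ! k)"
proof -
  let ?A = "\<lambda>p. good j p \<or> good k p"
  have "p_alt t (tensor_of j) (tensor_of k) =
    alternate True (2 * (K * L)) (\<lambda>bs. \<not> ?A (walk (2 ^ L) (1, 0, 0, 0) bs))"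
    by (simp add: p_alt_def tensor_of_def)
  also have "\<dots> \<longleftrightarrow> \<not> wins (2 ^ L) ?A (K * L) (1, 0, 0, 0)"
    by (rule alternate_walk_iff_wins)
  also have "\<dots> \<longleftrightarrow> \<not> bp_accepts (bpsp_prog I) (strings ! j @ strings ! k)"
    using wins_iff_accepts[of ?A] good_pair_iff[OF assms] by blast
  finally show ?thesis by simp
qed

lemma oapt_yes_target: "oapt_yes target \<longleftrightarrow> bpsp_yes I"
proof -
  have "oapt_yes target \<longleftrightarrow> (\<exists>j \<in> {..<N}. \<exists>k \<in> {N..<2 * N}. \<not> p_alt t (tensor_of j) (tensor_of k))"
    by (auto simp: oapt_yes_def target_def)
  also have "\<dots> \<longleftrightarrow> (\<exists>j \<in> {..<N}. \<exists>k \<in> {N..<2 * N}.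
      bp_accepts (bpsp_prog I) (strings ! j @ strings ! k))"
    by (intro bex_cong refl p_alt_tensor_of) auto
  also have "\<dots> \<longleftrightarrow> (\<exists>j < N. \<exists>k < N.
      bp_accepts (bpsp_prog I) (bpsp_left I ! j @ bpsp_right I ! k))"
    (is "?X \<longleftrightarrow> ?Y")
  proof
    assume ?X
    then obtain j k where "j < N" "N \<le> k" "k < 2 * N"
      "bp_accepts (bpsp_prog I) (strings ! j @ strings ! k)" by auto
    then show ?Y
      by (intro exI[of _ j] conjI exI[of _ "k - N"]) (auto simp: nth_append length_left)
  next
    assume ?Y
    then obtain j k where "j < N" "k < N"
      "bp_accepts (bpsp_prog I) (bpsp_left I ! j @ bpsp_right I ! k)" by auto
    then show ?X
      by (intro bexI[of _ j] bexI[of _ "N + k"]) (auto simp: nth_append length_left)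
  qed
  also have "\<dots> \<longleftrightarrow> bpsp_yes I"
    unfolding bpsp_yes_def by (metis in_set_conv_nth length_left length_right)
  finally show ?thesis .
qed

section \<open>Memory layout of the input and the output\<close>

abbreviation "edge_base \<equiv> T + 3"
abbreviation "string_base \<equiv> edge_base + (T - 1) * W * W * 2"
text \<open>The output starts right behind the input, whose length this is. The \<open>T + 3\<close>
  in \<open>edge_base\<close> counts 4 header words and \<open>T - 1\<close> variable
  labels.\<close>

abbreviation "out_base \<equiv> string_base + 2 * (N * h)"

definition edge_table :: "nat list" where
  "edge_table = [of_bool (edge i u b v).
     i \<leftarrow> [0..<T - 1], u \<leftarrow> [0..<W], v \<leftarrow> [0..<W], b \<leftarrow> [False, True]]"

lemma encode_eq:
  "encode_bpsp I = [N, 2 * h, T, W] @ map var [0..<T - 1] @ edge_table @ map of_bool (concat strings)"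
  by (simp add: encode_bpsp_def edge_table_def Let_def length_left flip: inputs_eq)

lemma length_edge_table: "length edge_table = (T - 1) * W * W * 2"
  unfolding edge_table_def
  by (simp add: length_concat comp_def sum_list_triv)

text \<open>A Horner address with the mark as its last digit: the bit read from a string is simply
  added to the address, without a branch.\<close>

lemma edge_table_nth:
  assumes "s + 1 < T" "u < W" "v < W"
  shows "edge_table ! (((s * W + u) * W + v) * 2 + of_bool b) = of_bool (edge s u b v)"
proof -
  let ?f3 = "\<lambda>i u v. map (\<lambda>b. of_bool (edge i u b v) :: nat) [False, True]"
  let ?f2 = "\<lambda>i u. concat (map (?f3 i u) [0..<W])"
  let ?f1 = "\<lambda>i. concat (map (?f2 i) [0..<W])"
  have l2: "length (?f2 i u) = W * 2" for i u
    by (subst length_concat_map_uniform[where k = 2]) auto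
  have l1: "length (?f1 i) = W * (W * 2)" for i
    by (subst length_concat_map_uniform[where k = "W * 2"]) (simp_all only: l2, simp)
  have b3: "v * 2 + of_bool b < W * 2"
    using assms by (cases b) auto
  have b2: "u * (W * 2) + (v * 2 + of_bool b) < W * (W * 2)"
  proof -
    have "u * (W * 2) + (v * 2 + of_bool b) < Suc u * (W * 2)"
      using b3 by simp
    also have "\<dots> \<le> W * (W * 2)"
      using assms by (intro mult_le_mono1) simp
    finally show ?thesis .
  qed
  have "edge_table ! (((s * W + u) * W + v) * 2 + of_bool b) =
    concat (map ?f1 [0..<T - 1]) ! (s * (W * (W * 2)) + (u * (W * 2) + (v * 2 + of_bool b)))"
    by (simp add: edge_table_def algebra_simps)
  also have "\<dots> = ?f1 ([0..<T - 1] ! s) ! (u * (W * 2) + (v * 2 + of_bool b))"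
    using assms b2 by (intro nth_concat_map_uniform l1) auto
  also have "\<dots> = ?f2 s ([0..<W] ! u) ! (v * 2 + of_bool b)"
    using assms b3 by (subst nth_concat_map_uniform[OF l2]) auto
  also have "\<dots> = ?f3 s u ([0..<W] ! v) ! of_bool b"
    using assms by (subst nth_concat_map_uniform[where k = 2]) auto
  also have "\<dots> = of_bool (edge s u b v)"
    using assms by (cases b) auto
  finally show ?thesis .
qed

lemma length_concat_strings: "length (concat strings) = 2 * N * h"
  using length_concat_map_uniform[of strings "\<lambda>x. x" h] length_string
  by (simp add: length_left length_right)

lemma length_encode: "length (encode_bpsp I) = out_base"
  using length_ge by (simp add: encode_eq length_edge_table length_concat_strings del: concat_append)

lemma encode_nth_header:
  "encode_bpsp I ! 0 = N" "encode_bpsp I ! 1 = 2 * h" "encode_bpsp I ! 2 = T" "encode_bpsp I ! 3 = W"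
  by (simp_all add: encode_eq)

lemma encode_nth_var: "s + 1 < T \<Longrightarrow> encode_bpsp I ! (4 + s) = var s"
  by (simp add: encode_eq nth_append less_diff_conv)

lemma edge_address_less:
  assumes "s + 1 < T" "u < W" "v < W"
  shows "((s * W + u) * W + v) * 2 + of_bool b < (T - 1) * W * W * 2"
proof -
  have 1: "s * W + u < (T - 1) * W"
  proof -
    have "Suc s * W \<le> (T - 1) * W"
      using assms by (intro mult_le_mono1) simp
    with assms show ?thesis by simp
  qed
  have "(s * W + u) * W + v < (T - 1) * W * W"
    using mult_le_mono1[of "Suc (s * W + u)" "(T - 1) * W" W] 1 assms by simp
  then show ?thesis by (cases b) auto
qed

lemma encode_nth_edge:
  assumes "s + 1 < T" "u < W" "v < W"
  shows "encode_bpsp I ! (((s * W + u) * W + v) * 2 + of_bool b + edge_base) = of_bool (edge s u b v)"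
proof -
  let ?i = "((s * W + u) * W + v) * 2 + of_bool b"
  have "encode_bpsp I =
    ([N, 2 * h, T, W] @ map var [0..<T - 1]) @ edge_table @ map of_bool (concat strings)"
    by (simp add: encode_eq)
  moreover have "length ([N, 2 * h, T, W] @ map var [0..<T - 1]) = edge_base"
    using length_ge by simp
  ultimately have "encode_bpsp I ! (?i + edge_base) = (edge_table @ map of_bool (concat strings)) ! ?i"
    by (metis nth_append_length_plus add.commute)
  also have "\<dots> = edge_table ! ?i"
    using edge_address_less[OF assms, of b] by (simp only: nth_append length_edge_table if_True)
  finally show ?thesis
    using edge_table_nth[OF assms] by simp
qed

lemma string_address_less:
  assumes "j < 2 * N" "y < h"
  shows "j * h + y < 2 * (N * h)"
  using mult_le_mono1[of "Suc j" "2 * N" h] assms by simp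

lemma encode_nth_string:
  assumes "j < 2 * N" "y < h"
  shows "encode_bpsp I ! (j * h + y + string_base) = of_bool (strings ! j ! y)"
proof -
  have "encode_bpsp I =
    ([N, 2 * h, T, W] @ map var [0..<T - 1] @ edge_table) @ map of_bool (concat strings)"
    by (simp add: encode_eq)
  moreover have "length ([N, 2 * h, T, W] @ map var [0..<T - 1] @ edge_table) = string_base"
    using length_ge by (simp add: length_edge_table)
  ultimately have "encode_bpsp I ! (j * h + y + string_base) = map of_bool (concat strings) ! (j * h + y)"
    by (metis nth_append_length_plus add.commute)
  also have "\<dots> = of_bool (concat strings ! (j * h + y))"
    using string_address_less[OF assms] by (intro nth_map) (simp only: length_concat_strings mult.assoc)
  also have "concat strings ! (j * h + y) = strings ! j ! y"
    using nth_concat_map_uniform[of strings "\<lambda>x. x" h j y] length_string assms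
    by (simp add: length_left length_right)
  finally show ?thesis .
qed

lemma encode_target_eq:
  "encode_oapt target = [N, t] @ concat (map (\<lambda>j. encode_tensor t (tensor_of j)) [0..<2 * N])"
proof -
  have "[0..<2 * N] = [0..<N] @ [N..<2 * N]"
    using upt_add_eq_append[of 0 N N] by (simp add: mult_2)
  then show ?thesis
    by (simp add: encode_oapt_def target_def comp_def)
qed

lemma length_encode_tensor: "length (encode_tensor k x) = 2 ^ k"
  by (simp add: encode_tensor_def length_product_lists_bools)

lemma length_encode_target: "length (encode_oapt target) = 2 + 2 * N * 2 ^ t"
  by (simp add: encode_target_eq length_concat_map_uniform[OF length_encode_tensor])

lemma encode_target_nth_header:
  "encode_oapt target ! 0 = N" "encode_oapt target ! 1 = t"
  by (simp_all add: encode_target_eq)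

lemma encode_target_nth:
  assumes "j < 2 * N" "length bs = t" "bs = product_lists (replicate t [False, True]) ! bits_val bs"
  shows "encode_oapt target ! (2 + (j * 2 ^ t + bits_val bs)) =
    of_bool (\<not> good j (walk (2 ^ L) (1, 0, 0, 0) bs))"
proof -
  have v: "bits_val bs < 2 ^ t"
    using bits_val_less[of bs] assms(2) by simp
  have "encode_oapt target ! (2 + (j * 2 ^ t + bits_val bs)) =
    concat (map (\<lambda>j. encode_tensor t (tensor_of j)) [0..<2 * N]) ! (j * 2 ^ t + bits_val bs)"
    by (simp add: encode_target_eq)
  also have "\<dots> = encode_tensor t (tensor_of ([0..<2 * N] ! j)) ! bits_val bs"
    using assms v by (intro nth_concat_map_uniform length_encode_tensor) auto
  also have "\<dots> = of_bool (tensor_of j bs)"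
    using assms(1) v assms(3)[symmetric] by (simp add: encode_tensor_def length_product_lists_bools)
  finally show ?thesis by (simp add: tensor_of_def)
qed

end

section \<open>The word-RAM program\<close>

definition wp :: "nat \<Rightarrow> com \<Rightarrow> state \<Rightarrow> (nat \<Rightarrow> state \<Rightarrow> bool) \<Rightarrow> bool" where
  "wp w p s Q \<longleftrightarrow> (\<exists>k s'. exec w p s k s' \<and> Q k s')"

lemma wp_mono: "wp w p s Q \<Longrightarrow> (\<And>k s'. Q k s' \<Longrightarrow> Q' k s') \<Longrightarrow> wp w p s Q'"
  unfolding wp_def by blast

text \<open>The conjunct \<open>c < 2 ^ w\<close> is the overflow condition: \<open>wp\<close>
  asserts that an execution exists, so every computed value leaves such a bound to prove.\<close>

lemma wp_Const: "wp w (Const r c) (R, M) Q \<longleftrightarrow> c < 2 ^ w \<and> Q 1 (R(r := c), M)"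
  unfolding wp_def by (auto simp del: split_paired_Ex intro: exec.Const[simplified] elim!: exec_elims(1))

lemma wp_Arith: "wp w (Arith f r r1 r2) (R, M) Q \<longleftrightarrow>
    arith_val f (R r1) (R r2) < 2 ^ w \<and> Q 1 (R(r := arith_val f (R r1) (R r2)), M)"
  unfolding wp_def by (auto simp del: split_paired_Ex intro: exec.Arith[simplified] elim!: exec_elims(2))

lemma wp_Load: "wp w (Load r r1) (R, M) Q \<longleftrightarrow> M (R r1) < 2 ^ w \<and> Q 1 (R(r := M (R r1)), M)"
  unfolding wp_def by (auto simp del: split_paired_Ex intro: exec.Load[simplified] elim!: exec_elims(3))

lemma wp_Store: "wp w (Store r1 r2) (R, M) Q \<longleftrightarrow> Q 1 (R, M(R r1 := R r2))"
  unfolding wp_def by (auto simp del: split_paired_Ex intro: exec.Store[simplified] elim!: exec_elims(4))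

lemma wp_Seq: "wp w (Seq p q) s Q \<longleftrightarrow> wp w p s (\<lambda>k s'. wp w q s' (\<lambda>l. Q (k + l)))"
  unfolding wp_def by (blast intro: exec.Seq elim!: exec_elims(5))

lemma wp_IfLess: "wp w (IfLess r1 r2 p q) (R, M) Q \<longleftrightarrow>
    (R r1 < R r2 \<longrightarrow> wp w p (R, M) (\<lambda>k. Q (1 + k))) \<and>
    (\<not> R r1 < R r2 \<longrightarrow> wp w q (R, M) (\<lambda>k. Q (1 + k)))"
  unfolding wp_def
  by (cases "R r1 < R r2")
    (auto simp del: split_paired_Ex intro: exec.IfTrue[simplified] exec.IfFalse[simplified]
      elim!: exec_elims(6))

lemmas wp_simps = wp_Const wp_Arith wp_Load wp_Store wp_Seq wp_IfLess

text \<open>The invariant is indexed by the number of finished iterations, which fixes their total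
  at \<open>n\<close>; each costs its body plus one test, and the last test adds 1.\<close>

lemma wp_WhileLess:
  assumes step: "\<And>i R M. i < n \<Longrightarrow> Inv i (R, M) \<Longrightarrow>
      R r1 < R r2 \<and> wp w p (R, M) (\<lambda>k s. k \<le> c \<and> Inv (Suc i) s)"
    and stop: "\<And>R M. Inv n (R, M) \<Longrightarrow> \<not> R r1 < R r2"
    and start: "Inv 0 s"
  shows "wp w (WhileLess r1 r2 p) s (\<lambda>k s'. k \<le> n * (c + 1) + 1 \<and> Inv n s')"
proof -
  have "wp w (WhileLess r1 r2 p) s (\<lambda>k s'. k \<le> m * (c + 1) + 1 \<and> Inv n s')"
    if "Inv i s" "i + m = n" for i m s
    using that
  proof (induction m arbitrary: i s)
    case 0
    obtain R M where s: "s = (R, M)" by (cases s)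
    with 0 stop have "\<not> R r1 < R r2" by simp
    with 0 show ?case
      unfolding wp_def s by (intro exI[of _ 1] exI[of _ "(R, M)"]) (auto simp del: One_nat_def intro: exec.WhileFalse)
  next
    case (Suc m)
    obtain R M where s: "s = (R, M)" by (cases s)
    with Suc.prems step[of i R M] obtain k s' where 1: "R r1 < R r2" "exec w p (R, M) k s'" "k \<le> c"
      "Inv (Suc i) s'"
      unfolding wp_def by auto
    from Suc.IH[OF 1(4)] Suc.prems obtain l s'' where
      2: "exec w (WhileLess r1 r2 p) s' l s''" "l \<le> m * (c + 1) + 1" "Inv n s''"
      unfolding wp_def by auto
    from 1 2 show ?case
      unfolding wp_def s
      by (intro exI[of _ "1 + k + l"] exI[of _ s'']) (auto simp del: One_nat_def plus_1_eq_Suc intro: exec.WhileTrue)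
  qed
  from this[of 0 s n] start show ?thesis by simp
qed

lemma wp_SeqI:
  assumes "wp w p s (\<lambda>k s'. k \<le> a \<and> A s')"
    and "\<And>s'. A s' \<Longrightarrow> wp w q s' (\<lambda>k s''. k \<le> b \<and> B s'')"
  shows "wp w (Seq p q) s (\<lambda>k s''. k \<le> a + b \<and> B s'')"
  unfolding wp_Seq
proof (rule wp_mono[OF assms(1)])
  fix k s' assume *: "k \<le> a \<and> A s'"
  then have "wp w q s' (\<lambda>l s''. l \<le> b \<and> B s'')"
    by (intro assms(2)) simp
  then show "wp w q s' (\<lambda>l s''. k + l \<le> a + b \<and> B s'')"
    by (rule wp_mono) (use * in simp)
qed

text \<open>Register 40 is a dummy target, written at the end of each block. Registers 0--8 and 10--14
  are set up once: 0 is the address of the output, 1 the number \<open>N\<close> of strings, 2 their length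
  \<open>n / 2\<close>, 3 and 4 are \<open>T - 1\<close> and \<open>W\<close>, 5 and 6 the addresses of the edges and of the strings,
  7 is \<open>2 ^ clog W\<close>, 8 the tensor size \<open>2 ^ t\<close>, 10 the number of entries to be written, and 11--14
  hold the constants 0, 1, 2, 4. Register 18 counts the entries written; the entry belongs to string
  number 20 (left ones first), 21 and 22 hold the undecoded rest of its index and the size of the range
  of that rest, 23--26 the game position, and 30 the entry itself.\<close>

fun block :: "com list \<Rightarrow> com" where
  "block [] = Const 40 0"
| "block (c # cs) = Seq c (block cs)"

text \<open>Once the range is halved, the quotient of the rest by it is the leading bit. The
  remainder takes a multiplication and a subtraction because the machine has no modulo
  instruction.\<close>

definition read_bit :: "nat \<Rightarrow> com list" where
  "read_bit b = [Arith Div 22 22 13, Arith Div b 21 22, Arith Mul 29 b 22, Arith Sub 21 21 29]"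

definition decode_round :: com where
  "decode_round = block (read_bit 27 @ read_bit 28 @
     [Arith Add 23 23 23, Arith Add 23 23 27,
      IfLess 23 7 (block [])
        (block [Arith Sub 23 23 7, Arith Add 26 26 26, Arith Add 26 26 28,
           IfLess 11 28 (block [Arith Add 24 23 11]) (block [Arith Add 25 23 11]),
           Const 23 1])])"

text \<open>Register 30 starts as 1, the entry of a leaf for which the string does not vouch, and
  every failed test leaves it so. The range tests precede the loads, so that no address outside the
  tables is used.\<close>

definition evaluate_leaf :: com where
  "evaluate_leaf = block [Const 30 1,
     IfLess 26 3
       (block [Arith Add 29 14 26, Load 31 29,
          IfLess 20 1 (block [Arith Add 32 11 11]) (block [Arith Add 32 2 11]),
          IfLess 31 32 (block [])
            (block [Arith Sub 31 31 32,
               IfLess 31 2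
                 (IfLess 24 4
                   (IfLess 25 4
                     (block [Arith Mul 29 20 2, Arith Add 29 29 31, Arith Add 29 29 6, Load 33 29,
                        Arith Mul 29 26 4, Arith Add 29 29 24, Arith Mul 29 29 4,
                        Arith Add 29 29 25, Arith Mul 29 29 13, Arith Add 29 29 33,
                        Arith Add 29 29 5, Load 29 29, Arith Sub 30 12 29])
                     (block []))
                   (block []))
                 (block [])])])
       (IfLess 11 24 (block []) (block [Const 30 0]))]"

definition start_entry :: com where
  "start_entry = block
     [Arith Div 20 18 8, Arith Mul 29 20 8, Arith Sub 21 18 29, Arith Add 22 8 11,
      Const 23 1, Const 24 0, Const 25 0, Const 26 0]"

definition finish_entry :: com where
  "finish_entry = block [Arith Add 29 0 13, Arith Add 29 29 18, Store 29 30, Arith Add 18 18 12]"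

definition output_entry :: com where
  "output_entry =
     Seq start_entry (Seq (WhileLess 12 22 decode_round) (Seq evaluate_leaf finish_entry))"

definition load_header :: com where
  "load_header = block
     [Const 11 0, Const 12 1, Const 13 2, Const 14 4, Const 15 3,
      Load 1 11, Load 2 12, Arith Div 2 2 13, Load 3 13, Load 4 15,
      Const 7 1, Const 16 0, Const 17 1, Const 8 1, Const 9 0]"

definition width_loop :: com where
  "width_loop = WhileLess 7 4 (block [Arith Add 7 7 7, Arith Add 16 16 12])"

text \<open>Each doubling towards \<open>T\<close> multiplies the tensor size by
  \<open>2 ^ L\<close> twice and adds \<open>L\<close> to the factor count twice, which replaces
  exponentiation and logarithm.\<close>

definition length_loop :: com where
  "length_loop = WhileLess 17 3 (block
     [Arith Add 17 17 17, Arith Mul 8 8 7, Arith Mul 8 8 7, Arith Add 9 9 16, Arith Add 9 9 16])"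

text \<open>The order matters: \<open>T + 3\<close> is formed before register 3 drops from
  \<open>T\<close> to \<open>T - 1\<close>.\<close>

definition prepare_output :: com where
  "prepare_output = block
     [Arith Add 5 3 15, Arith Sub 3 3 12, Arith Mul 6 3 4, Arith Mul 6 6 4, Arith Mul 6 6 13,
      Arith Add 6 5 6, Arith Mul 0 1 2, Arith Mul 0 13 0, Arith Add 0 6 0,
      Store 0 1, Arith Add 29 0 12, Store 29 9,
      Arith Mul 10 13 1, Arith Mul 10 10 8, Const 18 0]"

definition reduction :: com where
  "reduction = Seq load_header (Seq width_loop (Seq length_loop
     (Seq prepare_output (WhileLess 18 10 output_entry))))"

lemma bits_val_div: "bits_val (b # bs) div 2 ^ length bs = of_bool b"
  using bits_val_less[of bs] by simp

lemma bits_val_diff: "bits_val (b # bs) - of_bool b * 2 ^ length bs = bits_val bs"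
  by simp

text \<open>The segment number at most doubles per round, plus one. Counting every round as a
  halving is crude, but still keeps it below \<open>2 ^ t\<close>.\<close>

lemma advance_bounds:
  assumes "advance (2 ^ L) e h (m, u, v, s) = (m', u', v', s')" "m < 2 ^ L" "s < 2 ^ i" "0 < L"
  shows "m' < 2 ^ L" "s' < 2 ^ Suc i"
proof -
  have L: "1 < (2::nat) ^ L"
    using assms(4) by (intro one_less_power) simp_all
  have s: "s < 2 ^ Suc i" "2 * s < 2 ^ Suc i" "2 * s + 1 < 2 ^ Suc i"
    using assms(3) by simp_all
  show "m' < 2 ^ L" "s' < 2 ^ Suc i"
    using assms(1) L s by (auto simp: Let_def simp del: power_Suc split: if_splits)
qed

text \<open>Both factors are at least 1, so the product dominates each of them, and
  \<open>2 * N * P\<close> too; the 8 leaves room for intermediate doublings.\<close>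

lemma word_bounds_aux:
  fixes B P :: nat
  assumes "8 * B * P < 2 ^ w" "1 \<le> P" "2 * N \<le> B" "4 \<le> B"
  shows "8 * B < 2 ^ w" "8 * P < 2 ^ w" "B + (2 + 2 * N * P) < 2 ^ w"
proof -
  have 1: "B * 1 \<le> B * P" "1 * P \<le> B * P" "2 * N * P \<le> B * P"
    using assms by (intro mult_le_mono; simp)+
  have 2: "8 * (B * P) < 2 ^ w"
    using assms(1) by (simp only: mult.assoc)
  show "8 * B < 2 ^ w" "8 * P < 2 ^ w" "B + (2 + 2 * N * P) < 2 ^ w"
    using 1 2 assms(4) by linarith+
qed

text \<open>The memory is arbitrary; what it holds at an address is assumed only under the tests
  that guard the corresponding load.\<close>

lemma wp_evaluate_leaf_aux:
  fixes R M :: "nat \<Rightarrow> nat" and N h T1 W eb sb f off :: nat and x g :: bool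
  assumes R: "R 1 = N" "R 2 = h" "R 3 = T1" "R 4 = W" "R 5 = eb" "R 6 = sb"
      "R 11 = 0" "R 12 = 1" "R 13 = 2" "R 14 = 4"
    and w: "8 < (2::nat) ^ w" and W: "2 \<le> W"
    and off: "off = (if R 20 < N then 0 else h)"
    and query: "R 26 < T1 \<Longrightarrow> M (4 + R 26) = f \<and> f < 2 ^ w \<and> h < 2 ^ w \<and> 4 + R 26 < 2 ^ w"
    and edge: "R 26 < T1 \<Longrightarrow> off \<le> f \<Longrightarrow> f < off + h \<Longrightarrow> R 24 < W \<Longrightarrow> R 25 < W \<Longrightarrow>
      M (R 20 * h + (f - off) + sb) = of_bool x \<and> R 20 * h + (f - off) + sb < 2 ^ w \<and>
      M (((R 26 * W + R 24) * W + R 25) * 2 + of_bool x + eb) = of_bool g \<and>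
      ((R 26 * W + R 24) * W + R 25) * 2 + of_bool x + eb < 2 ^ w"
  shows "wp w evaluate_leaf (R, M) (\<lambda>k s'. k \<le> 40 \<and> (\<exists>R'. s' = (R', M) \<and>
    (\<forall>r < 20. R' r = R r) \<and> R' 30 = of_bool (\<not> (if R 26 < T1
      then off \<le> f \<and> f < off + h \<and> R 24 < W \<and> R 25 < W \<and> g else R 24 = 0))))"
proof (cases "R 26 < T1")
  case False
  then show ?thesis
    unfolding evaluate_leaf_def using R w by (auto simp: wp_simps)
next
  case s: True
  note q = query[OF s]
  show ?thesis
  proof (cases "off \<le> f \<and> f < off + h \<and> R 24 < W \<and> R 25 < W")
    case False
    with R w s q off show ?thesis
      unfolding evaluate_leaf_def by (cases "R 20 < N") (auto simp: wp_simps less_imp_diff_less)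
  next
    case ok: True
    define y a c where defs: "y = f - off" "a = R 20 * h" "c = R 26 * W + R 24"
    have mem: "M (a + y + sb) = of_bool x" "M ((c * W + R 25) * 2 + of_bool x + eb) = of_bool g"
      and less: "a + y + sb < 2 ^ w" "(c * W + R 25) * 2 + of_bool x + eb < 2 ^ w"
      using edge[OF s] ok unfolding defs by auto
    \<comment> \<open>No partial result of the Horner scheme exceeds the final address, so the bound
      on that address excludes overflow throughout.\<close>
    have "c * 1 \<le> c * W"
      using W by (intro mult_le_mono2) simp
    then have "c \<le> c * W"
      by simp
    moreover have "R 26 * W \<le> c"
      by (simp add: defs)
    moreover have "r < B \<and> c < B \<and> d < B \<and> d + v < B \<and> (d + v) * 2 < B \<and> (d + v) * 2 + z < B"
      if "c \<le> d" "r \<le> c" "(d + v) * 2 + z + eb < B" for r c d v z eb B :: nat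
      using that by auto
    ultimately have c: "R 26 * W < 2 ^ w" "c < 2 ^ w" "c * W < 2 ^ w" "c * W + R 25 < 2 ^ w"
      "(c * W + R 25) * 2 < 2 ^ w" "(c * W + R 25) * 2 + of_bool x < 2 ^ w"
      using less(2) by blast+
    have y: "\<not> f < off" "y < h" "y < 2 ^ w" "a < 2 ^ w" "a + y < 2 ^ w"
      using ok less q by (auto simp: defs(1))
    have bit: "of_bool b < (2::nat) ^ w" "1 - of_bool b < (2::nat) ^ w" for b
      using w by (cases b; simp)+
    have ac: "R 20 * h = a" "R 26 * W + R 24 = c"
      by (simp_all add: defs)
    show ?thesis
    proof (cases "R 20 < N")
      case True
      then have "f = y"
        by (simp add: defs off)
      with True show ?thesis
        unfolding evaluate_leaf_def using R w s q ok mem less c y bit ac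
        by (simp add: wp_simps del: One_nat_def)
    next
      case False
      then have "f - h = y" "\<not> f < h"
        using y(1) by (simp_all add: defs off)
      with False show ?thesis
        unfolding evaluate_leaf_def using R w s q ok mem less c y bit ac
        by (simp add: wp_simps del: One_nat_def)
    qed
  qed
qed

section \<open>Decoding an index and evaluating its leaf\<close>

locale reduction_run = bpsp_instance +
  fixes w :: nat
  assumes word_size: "8 * out_base * 2 ^ t < 2 ^ w"
begin

definition env :: "(nat \<Rightarrow> nat) \<Rightarrow> bool" where
  "env R \<longleftrightarrow> R 0 = out_base \<and> R 1 = N \<and> R 2 = h \<and> R 3 = T - 1 \<and> R 4 = W \<and> R 5 = edge_base \<and>
     R 6 = string_base \<and> R 7 = 2 ^ L \<and> R 8 = 2 ^ t \<and> R 10 = 2 * N * 2 ^ t \<and>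
     R 11 = 0 \<and> R 12 = 1 \<and> R 13 = 2 \<and> R 14 = 4"

lemma L_pos: "0 < L" and K_pos: "0 < K"
  using clog_pos[OF length_ge] clog_pos[OF width_ge] by auto

text \<open>As \<open>2 \<le> T\<close>, layer 0 queries a variable, so there are inputs at all.
  Hence the strings are nonempty and \<open>N\<close> is bounded by the input length.\<close>

lemma h_pos: "0 < h"
  using var_less[of 0] length_ge by simp

lemma out_base_ge: "4 \<le> out_base" "2 * N \<le> out_base" "2 * h \<le> out_base"
proof -
  have "N * 1 \<le> N * h" "1 * h \<le> N * h"
    using h_pos N_pos by (intro mult_le_mono; simp)+
  then show "4 \<le> out_base" "2 * N \<le> out_base" "2 * h \<le> out_base"
    using length_ge by linarith+
qed

lemma out_base_le: "8 * out_base < 2 ^ w" and size_le: "8 * 2 ^ t < (2::nat) ^ w"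
  and out_size_less: "out_base + (2 + 2 * N * 2 ^ t) < 2 ^ w"
  using word_bounds_aux[OF word_size one_le_power[OF one_le_numeral] out_base_ge(2,1)] .

lemma le_out_base_less: "x \<le> out_base \<Longrightarrow> x < 2 ^ w"
  using word_bounds_aux(1)[OF word_size one_le_power[OF one_le_numeral] out_base_ge(2,1)]
  by (rule le_less_trans[rotated]) (rule order.trans[OF _ mult_le_mono1[of 1 8]], simp_all)

lemma two_power_L_le: "2 ^ L \<le> (2::nat) ^ t"
proof (rule power_increasing)
  have "1 * L \<le> K * L"
    using K_pos by (intro mult_le_mono1) simp
  then show "L \<le> t" by simp
qed simp

lemma wp_decode_round:
  assumes env: "env R" and R: "R 22 = 2 ^ length (e # b # bs)" "R 21 = bits_val (e # b # bs)"
    and m: "R 23 < 2 ^ L" and s: "R 26 < 2 ^ i" "i < K * L" and len: "length (e # b # bs) \<le> t"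
  shows "wp w decode_round (R, M) (\<lambda>k s'. k \<le> 30 \<and> (\<exists>R'. s' = (R', M) \<and> env R' \<and>
    R' 18 = R 18 \<and> R' 20 = R 20 \<and> R' 22 = 2 ^ length bs \<and> R' 21 = bits_val bs \<and>
    (R' 23, R' 24, R' 25, R' 26) = advance (2 ^ L) e b (R 23, R 24, R 25, R 26)))"
proof -
  have big: "8 < (2::nat) ^ w"
    using size_le by (rule le_less_trans[rotated]) simp
  have len': "(2::nat) ^ Suc (Suc (length bs)) \<le> 2 ^ t"
    using len by (intro power_increasing) auto
  then have p: "8 * (2 * (2 * 2 ^ length bs)) < (2::nat) ^ w"
    using size_le by simp
  have bv: "bits_val (e # b # bs) < 2 ^ w" "bits_val (b # bs) < 2 ^ w" "bits_val bs < 2 ^ w"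
    using bits_val_less[of "e # b # bs"] bits_val_less[of "b # bs"] bits_val_less[of bs] p by auto
  have "(2::nat) ^ i \<le> 2 ^ t"
    using s by (intro power_increasing) auto
  then have s': "8 * R 26 < 2 ^ w"
    using s size_le by linarith
  have m': "8 * R 23 < 2 ^ w"
    using m two_power_L_le size_le by linarith
  define p a2 a1 a0 x y where defs: "p = (2::nat) ^ length bs" "a2 = bits_val (e # b # bs)"
    "a1 = bits_val (b # bs)" "a0 = bits_val bs" "x = (of_bool e :: nat)" "y = (of_bool b :: nat)"
  have facts: "a2 div (2 * p) = x" "a2 - x * (2 * p) = a1" "a1 div p = y" "a1 - y * p = a0"
    using bits_val_div[of e "b # bs"] bits_val_diff[of e "b # bs"]
      bits_val_div[of b bs] bits_val_diff[of b bs] unfolding defs by (simp_all only: length_Cons power_Suc)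
  have R22: "R 22 div 2 = 2 * p" "2 * p div 2 = p"
    using R by (simp_all add: defs)
  have xy: "x \<le> 1" "y \<le> 1"
    by (simp_all add: defs)
  have "x * (2 * p) \<le> 1 * (2 * p)" "y * p \<le> 1 * p"
    using xy by (intro mult_le_mono1; simp)+
  then have small: "x * (2 * p) < 2 ^ w" "y * p < 2 ^ w" "x < 2 ^ w" "y < 2 ^ w"
    "R 23 + R 23 + x < 2 ^ w" "R 23 + R 23 < 2 ^ w" "R 23 + R 23 + x - 2 ^ L < 2 ^ w"
    "R 26 + R 26 + y < 2 ^ w" "R 26 + R 26 < 2 ^ w" "p < 2 ^ w" "2 * p < 2 ^ w"
    "0 < (2::nat) ^ w" "1 < (2::nat) ^ w"
    using p[folded defs(1)] m' s' big xy by linarith+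
  have adv: "advance (2 ^ L) e b (R 23, R 24, R 25, R 26) =
    (if R 23 + R 23 + x < 2 ^ L then (R 23 + R 23 + x, R 24, R 25, R 26)
     else if 0 < y then (1, R 23 + R 23 + x - 2 ^ L, R 25, R 26 + R 26 + y)
     else (1, R 24, R 23 + R 23 + x - 2 ^ L, R 26 + R 26 + y))"
    by (simp add: Let_def mult_2 defs)
  note envD = env[unfolded env_def]
  show ?thesis
    unfolding decode_round_def read_bit_def adv defs(1)[symmetric] defs(4)[symmetric]
    using envD R(2)[folded defs(2)] facts small bv[folded defs(2-4)] R22
    by (simp add: wp_simps env_def del: One_nat_def)
qed

lemma wp_decode:
  assumes env: "env R" and R: "R 22 = 2 ^ t" "R 21 = bits_val bs" "length bs = t"
    and pos: "(R 23, R 24, R 25, R 26) = (1, 0, 0, 0)"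
  shows "wp w (WhileLess 12 22 decode_round) (R, M) (\<lambda>k s'. k \<le> K * L * 31 + 1 \<and>
    (\<exists>R'. s' = (R', M) \<and> env R' \<and> R' 18 = R 18 \<and> R' 20 = R 20 \<and>
    (R' 23, R' 24, R' 25, R' 26) = walk (2 ^ L) (1, 0, 0, 0) bs))"
proof -
  \<comment> \<open>The undecoded suffix \<open>cs\<close> leads from the current position to the
    same leaf as all of \<open>bs\<close> does from the start. The bounds on registers 23 and 26
    exclude overflow in the next round.\<close>
  define Inv where "Inv i s' \<longleftrightarrow> (\<exists>R' cs. s' = (R', M) \<and> env R' \<and> R' 18 = R 18 \<and> R' 20 = R 20 \<and>
     length cs = 2 * (K * L - i) \<and> R' 22 = 2 ^ length cs \<and> R' 21 = bits_val cs \<and>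
     R' 23 < 2 ^ L \<and> R' 26 < 2 ^ i \<and>
     walk (2 ^ L) (R' 23, R' 24, R' 25, R' 26) cs = walk (2 ^ L) (1, 0, 0, 0) bs)" for i s'
  have "wp w (WhileLess 12 22 decode_round) (R, M) (\<lambda>k s'. k \<le> K * L * (30 + 1) + 1 \<and> Inv (K * L) s')"
  proof (rule wp_WhileLess)
    show "Inv 0 (R, M)"
      unfolding Inv_def using env R pos one_less_power[of "2::nat" L] L_pos
      by (intro exI[of _ R] exI[of _ bs]) auto
  next
    fix R' M' assume "Inv (K * L) (R', M')"
    then show "\<not> R' 12 < R' 22"
      by (auto simp: Inv_def env_def)
  next
    fix i R1 M1 assume i: "i < K * L" and "Inv i (R1, M1)"
    then obtain cs where inv: "M1 = M" "env R1" "R1 18 = R 18" "R1 20 = R 20"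
      "length cs = 2 * (K * L - i)" "R1 22 = 2 ^ length cs" "R1 21 = bits_val cs"
      "R1 23 < 2 ^ L" "R1 26 < 2 ^ i"
      "walk (2 ^ L) (R1 23, R1 24, R1 25, R1 26) cs = walk (2 ^ L) (1, 0, 0, 0) bs"
      unfolding Inv_def by auto
    have "2 \<le> length cs"
      using inv(5) i by simp
    then obtain e b ds where cs: "cs = e # b # ds"
      by (cases cs; cases "tl cs") auto
    have lds: "length ds = 2 * (K * L - Suc i)"
      using inv(5) i by (simp add: cs)
    have "wp w decode_round (R1, M1) (\<lambda>k s. k \<le> 30 \<and> Inv (Suc i) s)"
    proof (rule wp_mono[OF wp_decode_round[of R1 e b ds i M1]])
      fix k :: nat and s assume *: "k \<le> 30 \<and> (\<exists>R'. s = (R', M1) \<and> env R' \<and>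
        R' 18 = R1 18 \<and> R' 20 = R1 20 \<and> R' 22 = 2 ^ length ds \<and> R' 21 = bits_val ds \<and>
        (R' 23, R' 24, R' 25, R' 26) = advance (2 ^ L) e b (R1 23, R1 24, R1 25, R1 26))"
      then obtain R' where R': "s = (R', M1)" "env R'"
        "R' 18 = R1 18" "R' 20 = R1 20" "R' 22 = 2 ^ length ds" "R' 21 = bits_val ds"
        "advance (2 ^ L) e b (R1 23, R1 24, R1 25, R1 26) = (R' 23, R' 24, R' 25, R' 26)"
        by metis
      have "R' 23 < 2 ^ L" "R' 26 < 2 ^ Suc i"
        using advance_bounds[OF R'(7) inv(8,9) L_pos] by auto
      moreover have "walk (2 ^ L) (R' 23, R' 24, R' 25, R' 26) ds = walk (2 ^ L) (1, 0, 0, 0) bs"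
        using inv(10) unfolding cs by (simp only: walk.simps R'(7))
      ultimately have "Inv (Suc i) s"
        unfolding Inv_def using R' inv(1,3,4) lds by (intro exI[of _ R'] exI[of _ ds]) simp
      with * show "k \<le> 30 \<and> Inv (Suc i) s" by blast
    qed (use inv i in \<open>simp_all add: cs\<close>)
    moreover have "R1 12 < R1 22"
      using inv(2,6) one_less_power[of "2::nat" "length cs"] cs
      by (simp add: env_def)
    ultimately show "R1 12 < R1 22 \<and> wp w decode_round (R1, M1) (\<lambda>k s. k \<le> 30 \<and> Inv (Suc i) s)"
      by blast
  qed
  then show ?thesis
    by (rule wp_mono) (auto simp: Inv_def)
qed

definition holds_input :: "(nat \<Rightarrow> nat) \<Rightarrow> bool" where
  "holds_input M \<longleftrightarrow> (\<forall>i < out_base. M i = encode_bpsp I ! i)"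

lemma env_cong: "env R \<Longrightarrow> (\<And>r. r < 18 \<Longrightarrow> R' r = R r) \<Longrightarrow> env R'"
  by (simp add: env_def)

lemma wp_evaluate_leaf:
  assumes env: "env R" and M: "holds_input M" and j: "R 20 < 2 * N"
  shows "wp w evaluate_leaf (R, M) (\<lambda>k s'. k \<le> 40 \<and> (\<exists>R'. s' = (R', M) \<and> env R' \<and>
    R' 18 = R 18 \<and> R' 30 = of_bool (\<not> good (R 20) (R 23, R 24, R 25, R 26))))"
proof -
  note envD = env[unfolded env_def]
  let ?j = "R 20" and ?u = "R 24" and ?v = "R 25" and ?s = "R 26"
  let ?f = "var ?s" and ?o = "offset ?j"
  let ?x = "strings ! ?j ! (?f - ?o)"
  let ?a = "((?s * W + ?u) * W + ?v) * 2 + of_bool ?x"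
  have in_input: "M i = encode_bpsp I ! i" "i < 2 ^ w" if "i < out_base" for i
    using M that le_out_base_less[of i] by (simp_all add: holds_input_def)
  have query: "M (4 + ?s) = ?f \<and> ?f < 2 ^ w \<and> h < 2 ^ w \<and> 4 + ?s < 2 ^ w" if "?s < T - 1"
  proof -
    have s: "?s + 1 < T"
      using that by simp
    have "?f \<le> out_base"
      using var_less[OF s] out_base_ge(3) by (rule order.trans[OF less_imp_le])
    moreover have "h \<le> out_base"
      by (rule order.trans[OF _ out_base_ge(3)]) simp
    moreover have "4 + ?s < out_base"
      using s by simp
    ultimately show ?thesis
      using in_input[of "4 + ?s"] encode_nth_var[OF s] le_out_base_less by simp
  qed
  have edge: "M (?j * h + (?f - ?o) + string_base) = of_bool ?x \<and>
      ?j * h + (?f - ?o) + string_base < 2 ^ w \<and>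
      M (?a + edge_base) = of_bool (edge ?s ?u ?x ?v) \<and> ?a + edge_base < 2 ^ w"
    if "?s < T - 1" "?o \<le> ?f" "?f < ?o + h" "?u < W" "?v < W"
  proof -
    have s: "?s + 1 < T"
      using that by simp
    have y: "?f - ?o < h"
      using that by auto
    have "?j * h + (?f - ?o) + string_base < out_base"
      using string_address_less[OF j y] by simp
    moreover have "?a + edge_base < out_base"
      using edge_address_less[OF s that(4,5), of ?x] by simp
    ultimately show ?thesis
      using in_input encode_nth_string[OF j y] encode_nth_edge[OF s that(4,5)] by simp
  qed
  have "8 \<le> (8::nat) * 2 ^ t"
    by simp
  then have w: "8 < (2::nat) ^ w"
    using size_le by (rule le_less_trans)
  let ?g = "if ?s < T - 1
      then ?o \<le> ?f \<and> ?f < ?o + h \<and> ?u < W \<and> ?v < W \<and> edge ?s ?u ?x ?v else ?u = 0"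
  have "wp w evaluate_leaf (R, M) (\<lambda>k s'. k \<le> 40 \<and> (\<exists>R'. s' = (R', M) \<and>
    (\<forall>r < 20. R' r = R r) \<and> R' 30 = of_bool (\<not> ?g)))"
  proof (rule wp_evaluate_leaf_aux[where eb = edge_base and sb = string_base and N = N and x = ?x])
    show "?o = (if ?j < N then 0 else h)"
      by (rule offset_def)
  qed (fact query edge | simp only: envD w width_ge)+
  moreover have "?g \<longleftrightarrow> good ?j (R 23, ?u, ?v, ?s)"
    unfolding good.simps less_diff_conv ..
  ultimately have "wp w evaluate_leaf (R, M) (\<lambda>k s'. k \<le> 40 \<and> (\<exists>R'. s' = (R', M) \<and>
    (\<forall>r < 20. R' r = R r) \<and> R' 30 = of_bool (\<not> good ?j (R 23, ?u, ?v, ?s))))"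
    by (simp only:)
  then show ?thesis
  proof (rule wp_mono)
    fix k :: nat and s'
    assume *: "k \<le> 40 \<and> (\<exists>R'. s' = (R', M) \<and>
      (\<forall>r < 20. R' r = R r) \<and> R' 30 = of_bool (\<not> good ?j (R 23, ?u, ?v, ?s)))"
    then obtain R' where R': "s' = (R', M)" "\<forall>r < 20. R' r = R r"
      "R' 30 = of_bool (\<not> good ?j (R 23, ?u, ?v, ?s))"
      by blast
    have "env R'" "R' 18 = R 18"
      using R'(2) env_cong[OF env, of R'] by auto
    with * R' show "k \<le> 40 \<and> (\<exists>R'. s' = (R', M) \<and> env R' \<and>
      R' 18 = R 18 \<and> R' 30 = of_bool (\<not> good ?j (R 23, ?u, ?v, ?s)))"
      by blast
  qed
qed

end

section \<open>Setting up the parameters\<close>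

lemma wp_width_loop:
  assumes R: "R 4 = W" "R 7 = 1" "R 16 = 0" "R 12 = 1"
    and w: "2 * W < 2 ^ w" "clog W < 2 ^ w"
  shows "wp w width_loop (R, M) (\<lambda>k s'. k \<le> clog W * 4 + 1 \<and> (\<exists>R'. s' = (R', M) \<and>
    R' 7 = 2 ^ clog W \<and> R' 16 = clog W \<and> (\<forall>r. r \<noteq> 7 \<and> r \<noteq> 16 \<and> r < 40 \<longrightarrow> R' r = R r)))"
proof -
  define Inv where "Inv i s' \<longleftrightarrow> (\<exists>R'. s' = (R', M) \<and>
    R' 7 = 2 ^ i \<and> R' 16 = i \<and> (\<forall>r. r \<noteq> 7 \<and> r \<noteq> 16 \<and> r < 40 \<longrightarrow> R' r = R r))" for i s'
  have "wp w width_loop (R, M) (\<lambda>k s'. k \<le> clog W * (3 + 1) + 1 \<and> Inv (clog W) s')"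
    unfolding width_loop_def
  proof (rule wp_WhileLess)
    fix i R1 M1 assume i: "i < clog W" and "Inv i (R1, M1)"
    then have inv: "M1 = M" "R1 7 = 2 ^ i" "R1 16 = i" "\<forall>r. r \<noteq> 7 \<and> r \<noteq> 16 \<and> r < 40 \<longrightarrow> R1 r = R r"
      by (auto simp: Inv_def)
    have less: "2 ^ i < W"
      using i by (rule two_power_less_if_less_clog)
    have R1: "R1 4 = W" "R1 12 = 1"
      using inv(4) R by auto
    have "i + 1 < 2 ^ w" "2 ^ i + 2 ^ i < (2::nat) ^ w" "0 < (2::nat) ^ w"
      using i w less by linarith+
    then have "wp w (block [Arith Add 7 7 7, Arith Add 16 16 12]) (R1, M1)
       (\<lambda>k s. k \<le> 3 \<and> Inv (Suc i) s)"
      using inv R1 by (simp add: wp_simps Inv_def mult_2)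
    with less inv R1 show "R1 7 < R1 4 \<and> wp w (block [Arith Add 7 7 7, Arith Add 16 16 12]) (R1, M1)
       (\<lambda>k s. k \<le> 3 \<and> Inv (Suc i) s)"
      by simp
  next
    fix R1 M1 assume "Inv (clog W) (R1, M1)"
    then show "\<not> R1 7 < R1 4"
      using R le_two_power_clog[of W] by (auto simp: Inv_def not_less)
  qed (use R in \<open>simp add: Inv_def\<close>)
  then show ?thesis
    by (rule wp_mono) (simp add: Inv_def)
qed

lemma wp_length_loop:
  assumes R: "R 3 = T" "R 7 = 2 ^ L" "R 16 = L" "R 17 = 1" "R 8 = 1" "R 9 = 0"
    and w: "2 * T < 2 ^ w" "2 ^ (2 * (clog T * L)) < (2::nat) ^ w"
  shows "wp w length_loop (R, M) (\<lambda>k s'. k \<le> clog T * 7 + 1 \<and> (\<exists>R'. s' = (R', M) \<and>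
    R' 8 = 2 ^ (2 * (clog T * L)) \<and> R' 9 = 2 * (clog T * L) \<and>
    (\<forall>r. r \<noteq> 8 \<and> r \<noteq> 9 \<and> r \<noteq> 17 \<and> r < 40 \<longrightarrow> R' r = R r)))"
proof -
  define Inv where "Inv i s' \<longleftrightarrow> (\<exists>R'. s' = (R', M) \<and>
    R' 17 = 2 ^ i \<and> R' 8 = 2 ^ (2 * (i * L)) \<and> R' 9 = 2 * (i * L) \<and>
    (\<forall>r. r \<noteq> 8 \<and> r \<noteq> 9 \<and> r \<noteq> 17 \<and> r < 40 \<longrightarrow> R' r = R r))" for i s'
  let ?body = "block
     [Arith Add 17 17 17, Arith Mul 8 8 7, Arith Mul 8 8 7, Arith Add 9 9 16, Arith Add 9 9 16]"
  have "wp w length_loop (R, M) (\<lambda>k s'. k \<le> clog T * (6 + 1) + 1 \<and> Inv (clog T) s')"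
    unfolding length_loop_def
  proof (rule wp_WhileLess)
    fix i R1 M1 assume i: "i < clog T" and "Inv i (R1, M1)"
    then have inv: "M1 = M" "R1 17 = 2 ^ i" "R1 8 = 2 ^ (2 * (i * L))" "R1 9 = 2 * (i * L)"
        "\<forall>r. r \<noteq> 8 \<and> r \<noteq> 9 \<and> r \<noteq> 17 \<and> r < 40 \<longrightarrow> R1 r = R r"
      by (auto simp: Inv_def)
    have less: "2 ^ i < T"
      using i by (rule two_power_less_if_less_clog)
    have R1: "R1 3 = T" "R1 7 = 2 ^ L" "R1 16 = L"
      using inv(5) R by auto
    define a b where ab: "a = (2::nat) ^ (2 * (i * L))" "b = 2 * (i * L)"
    have step: "a * 2 ^ L * 2 ^ L = 2 ^ (2 * (Suc i * L))" "b + L + L = 2 * (Suc i * L)"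
      by (simp_all add: ab algebra_simps flip: power_add)
    \<comment> \<open>The partial sizes grow monotonically towards the final one, which fits into a
      word.\<close>
    have le: "2 * (Suc i * L) \<le> 2 * (clog T * L)"
      using i by (intro mult_le_mono) simp_all
    have "b + L + L < 2 ^ w"
      using le w(2) less_exp[of "2 * (clog T * L)"] unfolding step by linarith
    moreover have "a * 2 ^ L * 2 ^ L < (2::nat) ^ w"
      unfolding step using power_increasing[OF le, of "2::nat"] w(2) by linarith
    moreover from this have "a * 2 ^ L < (2::nat) ^ w"
      by (rule le_less_trans[rotated]) simp
    moreover have "2 ^ i + 2 ^ i < (2::nat) ^ w" "0 < (2::nat) ^ w"
      using w less by linarith+
    ultimately have "wp w ?body (R1, M1) (\<lambda>k s. k \<le> 6 \<and> Inv (Suc i) s)"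
      using inv[folded ab] R1 unfolding Inv_def step(1)[symmetric] unfolding step(2)[symmetric]
      by (simp add: wp_simps mult_2)
    with less inv R1 show "R1 17 < R1 3 \<and> wp w ?body (R1, M1) (\<lambda>k s. k \<le> 6 \<and> Inv (Suc i) s)"
      by simp
  next
    fix R1 M1 assume "Inv (clog T) (R1, M1)"
    then show "\<not> R1 17 < R1 3"
      using R le_two_power_clog[of T] by (auto simp: Inv_def not_less)
  qed (use R in \<open>simp add: Inv_def\<close>)
  then show ?thesis
    by (rule wp_mono) (simp add: Inv_def, blast)
qed

lemma wp_load_header:
  assumes M: "M 0 = N" "M 1 = 2 * h" "M 2 = T" "M 3 = W"
    and w: "8 < (2::nat) ^ w" "N < 2 ^ w" "2 * h < 2 ^ w" "T < 2 ^ w" "W < 2 ^ w"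
  shows "wp w load_header (R, M) (\<lambda>k s'. k \<le> 16 \<and> (\<exists>R'. s' = (R', M) \<and>
    R' 1 = N \<and> R' 2 = h \<and> R' 3 = T \<and> R' 4 = W \<and> R' 7 = 1 \<and> R' 8 = 1 \<and> R' 9 = 0 \<and> R' 11 = 0 \<and>
    R' 12 = 1 \<and> R' 13 = 2 \<and> R' 14 = 4 \<and> R' 15 = 3 \<and> R' 16 = 0 \<and> R' 17 = 1))"
  unfolding load_header_def using assms by (simp add: wp_simps)

lemma wp_prepare_output:
  fixes T W N h P k w :: nat and R M :: "nat \<Rightarrow> nat"
  defines "sb \<equiv> T + 3 + (T - 1) * W * W * 2"
  defines "out \<equiv> sb + 2 * (N * h)"
  assumes R: "R 1 = N" "R 2 = h" "R 3 = T" "R 4 = W" "R 8 = P" "R 9 = k"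
      "R 12 = 1" "R 13 = 2" "R 15 = 3"
    and W: "1 \<le> W" and w: "out + (2 + 2 * N * P) < 2 ^ w" and P: "1 \<le> P"
  shows "wp w prepare_output (R, M) (\<lambda>l s'. l \<le> 16 \<and> (\<exists>R'. s' = (R', M(out := N, out + 1 := k)) \<and>
    R' 0 = out \<and> R' 3 = T - 1 \<and> R' 5 = T + 3 \<and> R' 6 = sb \<and> R' 10 = 2 * N * P \<and> R' 18 = 0 \<and>
    (\<forall>r \<in> {1, 2, 4, 7, 8, 11, 12, 13, 14}. R' r = R r)))"
proof -
  define x where "x = (T - 1) * W"
  define y where "y = N * h"
  define z where "z = 2 * N * P"
  have "x * 1 \<le> x * W"
    using W by (intro mult_le_mono2) simp
  then have x: "x \<le> x * W"
    by simp
  define x' where "x' = x * W"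
  have sb: "sb = T + 3 + x' * 2" and out: "out = T + 3 + x' * 2 + 2 * y"
    by (simp_all add: sb_def out_def x_def x'_def y_def)
  have "2 * N * 1 \<le> z"
    unfolding z_def using P by (intro mult_le_mono2) simp
  then have b: "x < 2 ^ w" "x' < 2 ^ w" "x' * 2 < 2 ^ w" "T + 3 + x' * 2 < 2 ^ w" "T + 3 < 2 ^ w"
    "T - 1 < 2 ^ w" "y < 2 ^ w" "2 * y < 2 ^ w" "T + 3 + x' * 2 + 2 * y < 2 ^ w"
    "T + 3 + x' * 2 + 2 * y + 1 < 2 ^ w" "2 * N < 2 ^ w" "z < 2 ^ w" "0 < (2::nat) ^ w"
    using w x unfolding out z_def[symmetric] x'_def[symmetric] by linarith+
  have f: "(T - 1) * W = x" "x * W = x'" "N * h = y" "2 * N * P = z"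
    by (simp_all add: x_def x'_def y_def z_def)
  show ?thesis
    unfolding prepare_output_def sb out f using R b f
    by (simp add: wp_simps del: One_nat_def)
qed

section \<open>The output loop and the complete run\<close>

context reduction_run
begin

lemma wp_start_entry:
  assumes env: "env R" and g: "R 18 < 2 * N * 2 ^ t"
  shows "wp w start_entry (R, M) (\<lambda>k s'. k \<le> 9 \<and> (\<exists>R'. s' = (R', M) \<and> env R' \<and>
    R' 18 = R 18 \<and> R' 20 = R 18 div 2 ^ t \<and> R' 22 = 2 ^ t \<and> R' 21 = R 18 mod 2 ^ t \<and>
    (R' 23, R' 24, R' 25, R' 26) = (1, 0, 0, 0)))"
proof -
  define P where "P = (2::nat) ^ t"
  have R: "R 8 = P" "R 11 = 0"
    using env by (simp_all add: env_def P_def)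
  have "R 18 < 2 ^ w" "P < 2 ^ w" "1 < (2::nat) ^ w" "0 < (2::nat) ^ w"
    using g out_size_less size_le[folded P_def] one_le_power[of "2::nat" t, folded P_def]
    unfolding P_def by linarith+
  moreover have "R 18 div P \<le> R 18" "R 18 div P * P \<le> R 18"
    by simp_all
  ultimately have b: "R 18 div P < 2 ^ w" "R 18 div P * P < 2 ^ w" "R 18 - R 18 div P * P < 2 ^ w"
    "P < 2 ^ w" "1 < (2::nat) ^ w" "0 < (2::nat) ^ w"
    by linarith+
  have "wp w start_entry (R, M) (\<lambda>k s'. k \<le> 9 \<and> (\<exists>R'. s' = (R', M) \<and> (\<forall>r < 20. R' r = R r) \<and>
    R' 20 = R 18 div P \<and> R' 22 = P \<and> R' 21 = R 18 - R 18 div P * P \<and>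
    (R' 23, R' 24, R' 25, R' 26) = (1, 0, 0, 0)))"
    unfolding start_entry_def using R b by (simp add: wp_simps del: One_nat_def)
  then show ?thesis
    unfolding P_def[symmetric]
  proof (rule wp_mono)
    fix k :: nat and s'
    assume *: "k \<le> 9 \<and> (\<exists>R'. s' = (R', M) \<and> (\<forall>r < 20. R' r = R r) \<and>
      R' 20 = R 18 div P \<and> R' 22 = P \<and> R' 21 = R 18 - R 18 div P * P \<and>
      (R' 23, R' 24, R' 25, R' 26) = (1, 0, 0, 0))"
    then obtain R' where R': "s' = (R', M)" "\<forall>r < 20. R' r = R r" "R' 20 = R 18 div P" "R' 22 = P"
      "R' 21 = R 18 - R 18 div P * P" "(R' 23, R' 24, R' 25, R' 26) = (1, 0, 0, 0)"
      by blast
    moreover have "env R'" "R' 18 = R 18"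
      using R'(2) env_cong[OF env, of R'] by auto
    ultimately show "k \<le> 9 \<and> (\<exists>R'. s' = (R', M) \<and> env R' \<and>
      R' 18 = R 18 \<and> R' 20 = R 18 div P \<and> R' 22 = P \<and> R' 21 = R 18 mod P \<and>
      (R' 23, R' 24, R' 25, R' 26) = (1, 0, 0, 0))"
      using * by (metis minus_div_mult_eq_mod)
  qed
qed

text \<open>The invariant of the output loop. All writes go to addresses from
  \<open>out_base\<close> on, so the input stays readable for later entries; the 2 counts the output
  header.\<close>

definition written :: "nat \<Rightarrow> state \<Rightarrow> bool" where
  "written g s \<longleftrightarrow> (\<exists>R M. s = (R, M) \<and> env R \<and> R 18 = g \<and> holds_input M \<and>
     (\<forall>i < 2 + g. M (out_base + i) = encode_oapt target ! i))"

text \<open>\<open>R0\<close> holds the registers from the start of the entry: from there to this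
  single store the memory is unchanged, while the registers are not.\<close>

lemma wp_finish_entry:
  assumes env: "env R" and g: "R 18 < 2 * N * 2 ^ t" and M: "written (R 18) (R0, M)"
    and b: "R 30 = encode_oapt target ! (2 + R 18)"
  shows "wp w finish_entry (R, M) (\<lambda>k s'. k \<le> 5 \<and> written (Suc (R 18)) s')"
proof -
  define B where "B = out_base"
  have inp: "\<forall>i < B. M i = encode_bpsp I ! i"
    and out: "\<forall>i < 2 + R 18. M (B + i) = encode_oapt target ! i"
    using M unfolding written_def holds_input_def B_def by auto
  have R: "R 0 = B" "R 12 = 1" "R 13 = 2"
    using env by (simp_all add: env_def B_def)
  have less: "B + 2 < 2 ^ w" "B + 2 + R 18 < 2 ^ w" "R 18 + 1 < 2 ^ w" "0 < (2::nat) ^ w"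
    using out_size_less g unfolding B_def[symmetric] by linarith+
  have "wp w finish_entry (R, M) (\<lambda>k s'. k \<le> 5 \<and> (\<exists>R'. s' = (R', M(B + 2 + R 18 := R 30)) \<and>
    (\<forall>r < 18. R' r = R r) \<and> R' 18 = R 18 + 1))"
    unfolding finish_entry_def using R less by (simp add: wp_simps del: One_nat_def)
  then show ?thesis
  proof (rule wp_mono)
    fix k :: nat and s'
    assume *: "k \<le> 5 \<and> (\<exists>R'. s' = (R', M(B + 2 + R 18 := R 30)) \<and>
      (\<forall>r < 18. R' r = R r) \<and> R' 18 = R 18 + 1)"
    then obtain R' where R': "s' = (R', M(B + 2 + R 18 := R 30))" "\<forall>r < 18. R' r = R r"
      "R' 18 = R 18 + 1"
      by blast
    have "env R'"
      using R'(2) env_cong[OF env, of R'] by auto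
    moreover have "holds_input (M(B + 2 + R 18 := R 30))"
      unfolding holds_input_def B_def[symmetric] using inp by simp
    moreover have "(M(B + 2 + R 18 := R 30)) (B + i) = encode_oapt target ! i"
      if "i < 2 + Suc (R 18)" for i
      using that out b by (cases "i = 2 + R 18") auto
    ultimately show "k \<le> 5 \<and> written (Suc (R 18)) s'"
      unfolding written_def B_def[symmetric] using * R' by simp
  qed
qed

lemma wp_output_entry:
  assumes inv: "written g (R, M)" and g: "g < 2 * N * 2 ^ t"
  shows "wp w output_entry (R, M) (\<lambda>k s'. k \<le> K * L * 31 + 55 \<and> written (Suc g) s')"
proof -
  have R: "env R" "R 18 = g" and M: "holds_input M"
    using inv by (auto simp: written_def)
  define j where "j = g div 2 ^ t"
  define bs where "bs = product_lists (replicate t [False, True]) ! (g mod 2 ^ t)"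
  have r: "g mod 2 ^ t < 2 ^ t"
    by simp
  have bs: "length bs = t" "bits_val bs = g mod 2 ^ t"
    unfolding bs_def using product_lists_nth[OF r] by auto
  have j: "j < 2 * N"
    using g unfolding j_def by (simp add: less_mult_imp_div_less)
  have "j * 2 ^ t + bits_val bs = g"
    by (simp only: j_def bs div_mult_mod_eq)
  then have out: "encode_oapt target ! (2 + g) = of_bool (\<not> good j (walk (2 ^ L) (1, 0, 0, 0) bs))"
    using encode_target_nth[OF j bs(1)] bs bs_def by simp
  have "wp w output_entry (R, M) (\<lambda>k s'. k \<le> 9 + (K * L * 31 + 1 + (40 + 5)) \<and> written (Suc g) s')"
    unfolding output_entry_def
  proof (rule wp_SeqI[OF wp_start_entry[OF R(1), unfolded R(2), OF g]], elim exE conjE)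
    fix s1 :: state and R1 :: "nat \<Rightarrow> nat" assume 1: "s1 = (R1, M)" "env R1" "R1 18 = g" "R1 20 = g div 2 ^ t" "R1 22 = 2 ^ t"
      "R1 21 = g mod 2 ^ t" "(R1 23, R1 24, R1 25, R1 26) = (1, 0, 0, 0)"
    show "wp w (Seq (WhileLess 12 22 decode_round) (Seq evaluate_leaf finish_entry)) s1
      (\<lambda>k s'. k \<le> K * L * 31 + 1 + (40 + 5) \<and> written (Suc g) s')"
      unfolding 1(1)
    proof (rule wp_SeqI[OF wp_decode[OF 1(2) 1(5) 1(6)[folded bs(2)] bs(1) 1(7)]], elim exE conjE)
      fix s2 :: state and R2 :: "nat \<Rightarrow> nat" assume 2: "s2 = (R2, M)" "env R2" "R2 18 = R1 18" "R2 20 = R1 20"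
        "(R2 23, R2 24, R2 25, R2 26) = walk (2 ^ L) (1, 0, 0, 0) bs"
      have j2: "R2 20 = j" "R2 18 = g"
        using 1 2 by (simp_all add: j_def)
      show "wp w (Seq evaluate_leaf finish_entry) s2 (\<lambda>k s'. k \<le> 40 + 5 \<and> written (Suc g) s')"
        unfolding 2(1)
      proof (rule wp_SeqI[OF wp_evaluate_leaf[OF 2(2) M, unfolded j2, OF j]], elim exE conjE)
        fix s3 :: state and R3 :: "nat \<Rightarrow> nat" assume 3: "s3 = (R3, M)" "env R3" "R3 18 = g"
          "R3 30 = of_bool (\<not> good j (R2 23, R2 24, R2 25, R2 26))"
        have "R3 30 = encode_oapt target ! (2 + R3 18)"
          unfolding 3(3,4) out 2(5) ..
        then show "wp w finish_entry s3 (\<lambda>k s'. k \<le> 5 \<and> written (Suc g) s')"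
          using wp_finish_entry[OF 3(2), of R M] inv g unfolding 3(1,3) by simp
      qed
    qed
  qed
  then show ?thesis
    by (rule wp_mono) simp
qed

lemma wp_output_loop:
  assumes "written 0 s"
  shows "wp w (WhileLess 18 10 output_entry) s
    (\<lambda>k s'. k \<le> 2 * N * 2 ^ t * (K * L * 31 + 55 + 1) + 1 \<and> written (2 * N * 2 ^ t) s')"
proof (rule wp_WhileLess)
  fix i R M assume i: "i < 2 * N * 2 ^ t" and inv: "written i (R, M)"
  then have "R 18 < R 10"
    by (auto simp: written_def env_def)
  with wp_output_entry[OF inv i]
  show "R 18 < R 10 \<and> wp w output_entry (R, M) (\<lambda>k s'. k \<le> K * L * 31 + 55 \<and> written (Suc i) s')"
    by blast
next
  fix R M assume "written (2 * N * 2 ^ t) (R, M)"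
  then show "\<not> R 18 < R 10"
    by (auto simp: written_def env_def)
qed (rule assms)

lemma wp_reduction:
  "wp w reduction (init_state (encode_bpsp I))
    (\<lambda>k s'. k \<le> 16 + (L * 4 + 1 + (K * 7 + 1 + (16 + (2 * N * 2 ^ t * (K * L * 31 + 55 + 1) + 1))))
      \<and> written (2 * N * 2 ^ t) s')"
proof -
  define M where "M = snd (init_state (encode_bpsp I))"
  have init: "init_state (encode_bpsp I) = ((\<lambda>_. 0), M)"
    by (simp add: M_def init_state_def)
  have M: "holds_input M"
    unfolding holds_input_def M_def init_state_def length_encode by simp
  have "M i = encode_bpsp I ! i" if "i < 4" for i
    using M that out_base_ge(1) unfolding holds_input_def by (meson less_le_trans)
  then have header: "M 0 = N" "M 1 = 2 * h" "M 2 = T" "M 3 = W"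
    using encode_nth_header by simp_all
  \<comment> \<open>The edge table alone has at least \<open>2 * W\<close> entries, so the word
    bound for the input covers the last doubling in \<open>width_loop\<close>.\<close>
  have "W * 1 \<le> W * W" "1 * (W * W) \<le> (T - 1) * (W * W)"
    using length_ge width_ge by (intro mult_le_mono; simp)+
  then have "2 * W \<le> (T - 1) * W * W * 2"
    unfolding mult.assoc by linarith
  also have "\<dots> \<le> out_base"
    by simp
  finally have w2: "2 * W < 2 ^ w"
    by (rule le_out_base_less)
  have "8 * T < 2 ^ w"
    by (rule le_less_trans[OF _ out_base_le]) simp
  then have T2: "2 * T < 2 ^ w" "T < 2 ^ w"
    by linarith+
  have N: "N < 2 ^ w" and h: "2 * h < 2 ^ w"
    using out_base_ge(2,3)[THEN le_out_base_less] by linarith+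
  have "8 \<le> (8::nat) * 2 ^ t"
    by simp
  then have w8: "8 < (2::nat) ^ w"
    using size_le by (rule le_less_trans)
  have t: "2 ^ t < (2::nat) ^ w"
    using size_le by linarith
  have "L < 2 ^ w"
    using less_exp[of L] two_power_L_le t by linarith
  note header_rule = wp_load_header[OF header w8 N h T2(2)]
  have W: "W < 2 ^ w"
    using w2 by linarith
  show ?thesis
    unfolding reduction_def init
  proof (rule wp_SeqI[OF header_rule[OF W]], elim exE conjE)
    fix s1 :: state and R1 :: "nat \<Rightarrow> nat" assume 1: "s1 = (R1, M)" "R1 1 = N" "R1 2 = h" "R1 3 = T" "R1 4 = W" "R1 7 = 1" "R1 8 = 1"
      "R1 9 = 0" "R1 11 = 0" "R1 12 = 1" "R1 13 = 2" "R1 14 = 4" "R1 15 = 3" "R1 16 = 0" "R1 17 = 1"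
    show "wp w (Seq width_loop (Seq length_loop
       (Seq prepare_output (WhileLess 18 10 output_entry)))) s1
      (\<lambda>k s'. k \<le> L * 4 + 1 + (K * 7 + 1 + (16 + (2 * N * 2 ^ t * (K * L * 31 + 55 + 1) + 1)))
        \<and> written (2 * N * 2 ^ t) s')"
      unfolding 1(1)
    proof (rule wp_SeqI[OF wp_width_loop[OF 1(5,6,14,10) w2 \<open>L < 2 ^ w\<close>]], elim exE conjE)
      fix s2 :: state and R2 :: "nat \<Rightarrow> nat" assume 2: "s2 = (R2, M)" "R2 7 = 2 ^ L" "R2 16 = L"
        "\<forall>r. r \<noteq> 7 \<and> r \<noteq> 16 \<and> r < 40 \<longrightarrow> R2 r = R1 r"
      have R2: "R2 3 = T" "R2 17 = 1" "R2 8 = 1" "R2 9 = 0"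
        using 2(4) 1 by auto
      show "wp w (Seq length_loop (Seq prepare_output (WhileLess 18 10 output_entry))) s2
        (\<lambda>k s'. k \<le> K * 7 + 1 + (16 + (2 * N * 2 ^ t * (K * L * 31 + 55 + 1) + 1))
          \<and> written (2 * N * 2 ^ t) s')"
        unfolding 2(1)
      proof (rule wp_SeqI[OF wp_length_loop[OF R2(1) 2(2,3) R2(2,3,4) T2(1) t]], elim exE conjE)
        fix s3 :: state and R3 :: "nat \<Rightarrow> nat" assume 3: "s3 = (R3, M)" "R3 8 = 2 ^ t" "R3 9 = t"
          "\<forall>r. r \<noteq> 8 \<and> r \<noteq> 9 \<and> r \<noteq> 17 \<and> r < 40 \<longrightarrow> R3 r = R2 r"
        have R3: "R3 1 = N" "R3 2 = h" "R3 3 = T" "R3 4 = W" "R3 12 = 1" "R3 13 = 2" "R3 15 = 3"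
          "R3 7 = 2 ^ L" "R3 11 = 0" "R3 14 = 4"
          using 3(4) 2 1 by auto
        have W1: "1 \<le> W"
          using width_ge by simp
        show "wp w (Seq prepare_output (WhileLess 18 10 output_entry)) s3
          (\<lambda>k s'. k \<le> 16 + (2 * N * 2 ^ t * (K * L * 31 + 55 + 1) + 1)
            \<and> written (2 * N * 2 ^ t) s')"
          unfolding 3(1)
        proof (rule wp_SeqI[OF wp_prepare_output[OF R3(1-4) 3(2,3) R3(5-7) W1 out_size_less
                one_le_power[OF one_le_numeral]]], elim exE conjE)
          fix s4 :: state and R4 :: "nat \<Rightarrow> nat" assume 4: "s4 = (R4, M(out_base := N, out_base + 1 := t))" "R4 0 = out_base"
            "R4 3 = T - 1" "R4 5 = edge_base" "R4 6 = string_base" "R4 10 = 2 * N * 2 ^ t" "R4 18 = 0"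
            "\<forall>r \<in> {1, 2, 4, 7, 8, 11, 12, 13, 14}. R4 r = R3 r"
          have "env R4"
            unfolding env_def using 4(2-6,8) R3 3(2) by simp
          moreover have "holds_input (M(out_base := N, out_base + 1 := t))"
            using M by (auto simp: holds_input_def)
          moreover have "(M(out_base := N, out_base + 1 := t)) (out_base + i) = encode_oapt target ! i"
            if "i < 2" for i
            using that encode_target_nth_header by (auto simp: less_2_cases_iff)
          ultimately have "written 0 s4"
            unfolding written_def using 4(1,7) by (metis add_0_right)
          then show "wp w (WhileLess 18 10 output_entry) s4
            (\<lambda>k s'. k \<le> 2 * N * 2 ^ t * (K * L * 31 + 55 + 1) + 1 \<and> written (2 * N * 2 ^ t) s')"
            by (rule wp_output_loop)
        qed
      qed
    qed
  qed
qed

end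

section \<open>Constants of the time, size and word bounds\<close>

lemma time_bound:
  fixes N P K L :: nat
  assumes N: "1 \<le> N" and K: "0 < K" and L: "0 < L" and P: "K * L \<le> P"
  shows "16 + (L * 4 + 1 + (K * 7 + 1 + (16 + (2 * N * P * (K * L * 31 + 55 + 1) + 1))))
    \<le> 300 * (N * (P * P))"
proof -
  have KL: "1 * 1 \<le> K * L" "1 * L \<le> K * L" "K * 1 \<le> K * L"
    using K L by (intro mult_le_mono; simp)+
  then have P1: "1 \<le> P" "L \<le> P" "K \<le> P"
    using P by linarith+
  have "1 * (P * 1) \<le> N * (P * P)"
    using N P1 by (intro mult_le_mono) auto
  then have 1: "P \<le> N * (P * P)"
    by simp
  \<comment> \<open>The decoding time \<open>K * L\<close> of an entry is traded for a second factor
    \<open>P\<close>. Adding up all coefficients then gives 220, below the claimed 300.\<close>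
  have "N * P * (K * L) \<le> N * P * P" "N * P * 1 \<le> N * P * P"
    using P P1 by (intro mult_le_mono2; simp)+
  then have "N * P * (K * L) \<le> N * (P * P)" "N * P \<le> N * (P * P)"
    by (simp_all add: mult.assoc)
  moreover have "2 * N * P * (K * L * 31 + 55 + 1) = 62 * (N * P * (K * L)) + 112 * (N * P)"
    by (simp add: algebra_simps)
  ultimately show ?thesis
    using 1 P1 by linarith
qed

context bpsp_instance
begin

text \<open>Each of the two rounded logarithms contributes a factor 2, and the interleaved
  opponent's bits a third.\<close>

lemma factors_le: "real t \<le> 8 * (log 2 (real W) * log 2 (real T))"
proof -
  have "real K * real L \<le> (2 * log 2 (real T)) * (2 * log 2 (real W))"
    using clog_le_log[OF length_ge] clog_le_log[OF width_ge] length_ge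
    by (intro mult_mono) auto
  then show ?thesis by simp
qed

text \<open>On a logarithmic scale the demand is \<open>3 + log 2 B + t\<close>, where
  \<open>t\<close> is at most 8 times the product of the logarithms. Since
  \<open>2 \<le> log 2 B\<close>, the factor 12 also absorbs the 3.\<close>

lemma word_size_if:
  assumes "real w \<ge> 12 * (log 2 (real (length (encode_bpsp I))) + log 2 (real W) * log 2 (real T))"
  shows "8 * out_base * 2 ^ t < 2 ^ w"
proof -
  define B where "B = out_base"
  define x where "x = log 2 (real W) * log 2 (real T)"
  have "4 \<le> B"
    using length_ge by (simp add: B_def)
  then have "log 2 (2 ^ 2) \<le> log 2 (real B)"
    by (subst log_le_cancel_iff) auto
  then have B: "2 \<le> log 2 (real B)"
    by (subst (asm) log_pow_cancel) simp_all
  have x: "0 \<le> x"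
    using length_ge width_ge by (simp add: x_def)
  have "log 2 (8 * real B * 2 ^ t) = log 2 (2 ^ 3) + log 2 (real B) + log 2 (2 ^ t)"
    using \<open>4 \<le> B\<close> by (simp add: log_mult)
  also have "\<dots> = 3 + log 2 (real B) + real t"
    by (simp only: log_pow_cancel)
  also have "\<dots> < 12 * (log 2 (real B) + x)"
  proof -
    have "3 + b + r < 12 * (b + y)" if "r \<le> 8 * y" "2 \<le> b" "0 \<le> y" for b r y :: real
      using that by argo
    then show ?thesis
      using factors_le[folded x_def] B x by blast
  qed
  also have "\<dots> \<le> real w"
    using assms by (simp only: length_encode B_def x_def)
  also have "\<dots> = log 2 (2 ^ w)"
    by simp
  finally have "8 * real B * 2 ^ t < 2 ^ w"
    using \<open>4 \<le> B\<close> by (subst (asm) log_less_cancel_iff) auto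
  then have "real (8 * B * 2 ^ t) < real (2 ^ w)"
    by simp
  then show ?thesis
    unfolding B_def of_nat_less_iff .
qed

lemma computes_target:
  assumes w: "real w \<ge> 12 * (log 2 (real (length (encode_bpsp I))) + log 2 (real W) * log 2 (real T))"
  shows "\<exists>k. computes_in w reduction (encode_bpsp I) (encode_oapt target) k \<and>
    real k \<le> 300 * (real N * 2 powr (16 * (log 2 (real W) * log 2 (real T))))"
proof -
  interpret reduction_run I N w
    by unfold_locales (rule word_size_if[OF w])
  let ?x = "log 2 (real W) * log 2 (real T)"
  from wp_reduction obtain k s' where
    k: "k \<le> 16 + (L * 4 + 1 + (K * 7 + 1 + (16 + (2 * N * 2 ^ t * (K * L * 31 + 55 + 1) + 1))))"
    and exec: "exec w reduction (init_state (encode_bpsp I)) k s'" and s': "written (2 * N * 2 ^ t) s'"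
    unfolding wp_def by blast
  from s' obtain R M where RM: "s' = (R, M)" "R 0 = out_base"
    "\<forall>i < 2 + 2 * N * 2 ^ t. M (out_base + i) = encode_oapt target ! i"
    unfolding written_def env_def by auto
  have "computes_in w reduction (encode_bpsp I) (encode_oapt target) k"
    unfolding computes_in_def length_encode_target
  proof (intro exI conjI allI impI)
    show "exec w reduction (init_state (encode_bpsp I)) k (R, M)"
      using exec RM(1) by simp
    fix j assume j: "j < 2 + 2 * N * 2 ^ t"
    show "M (R 0 + j) = encode_oapt target ! j"
      using RM(2,3) j by simp
    show "R 0 + j < 2 ^ w"
      unfolding RM(2) using j out_size_less by linarith
  qed
  moreover have "real k \<le> 300 * (real N * 2 powr (16 * ?x))"
  proof -
    have "K * L \<le> 2 ^ t"
      using less_exp[of t] by linarith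
    with k have "k \<le> 300 * (N * (2 ^ t * 2 ^ t))"
      using time_bound[OF N_pos K_pos L_pos, of "2 ^ t"] by linarith
    then have "real k \<le> real (300 * (N * (2 ^ t * 2 ^ t)))"
      by (rule of_nat_mono)
    also have "\<dots> = 300 * (real N * 2 powr (real t + real t))"
    proof -
      have "2 powr (real t + real t) = 2 ^ t * 2 ^ t"
        by (simp only: powr_add powr_realpow zero_less_numeral)
      then show ?thesis by simp
    qed
    also have "\<dots> \<le> 300 * (real N * 2 powr (16 * ?x))"
      using factors_le by (intro mult_left_mono powr_mono) auto
    finally show ?thesis .
  qed
  ultimately show ?thesis by blast
qed

lemma size_target:
  "real (2 ^ oapt_factors target) \<le> 2 powr (8 * (log 2 (real W) * log 2 (real T)))"
proof -
  have "real (2 ^ oapt_factors target) = 2 powr real t"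
    by (simp add: target_def powr_realpow del: of_nat_mult)
  also have "\<dots> \<le> 2 powr (8 * (log 2 (real W) * log 2 (real T)))"
    using factors_le by (rule powr_mono) simp
  finally show ?thesis .
qed

end

theorem theorem5p1:
  "\<exists>(p :: com) (C :: real) (c :: real) (d :: real) (e :: real).
     \<forall>(I :: bpsp) (N :: nat) (T :: nat) (W :: nat).
       bpsp_wf I N \<and> bp_length (bpsp_prog I) = T \<and> bp_width (bpsp_prog I) = W \<and>
       1 \<le> N \<and> 2 \<le> T \<and> 2 \<le> W \<longrightarrow>
       (\<exists>J :: oapt.
          oapt_wf J N \<and>
          real (2 ^ oapt_factors J) \<le> 2 powr (d * (log 2 (real W) * log 2 (real T))) \<and>
          (oapt_yes J \<longleftrightarrow> bpsp_yes I) \<and>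
          (\<forall>w :: nat.
             real w \<ge> e * (log 2 (real (length (encode_bpsp I))) + log 2 (real W) * log 2 (real T)) \<longrightarrow>
             (\<exists>k :: nat.
                computes_in w p (encode_bpsp I) (encode_oapt J) k \<and>
                real k \<le> C * (real N * 2 powr (c * (log 2 (real W) * log 2 (real T)))))))"
proof (rule exI[of _ reduction], rule exI[of _ 300], rule exI[of _ 16], rule exI[of _ 8],
    rule exI[of _ 12], intro allI impI)
  fix I :: bpsp and N T W :: nat
  assume *: "bpsp_wf I N \<and> bp_length (bpsp_prog I) = T \<and> bp_width (bpsp_prog I) = W \<and>
    1 \<le> N \<and> 2 \<le> T \<and> 2 \<le> W"
  then have T: "T = bp_length (bpsp_prog I)" and W: "W = bp_width (bpsp_prog I)"
    by simp_all
  interpret bpsp_instance I N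
    using * by unfold_locales auto
  show "\<exists>J :: oapt.
      oapt_wf J N \<and>
      real (2 ^ oapt_factors J) \<le> 2 powr (8 * (log 2 (real W) * log 2 (real T))) \<and>
      (oapt_yes J \<longleftrightarrow> bpsp_yes I) \<and>
      (\<forall>w :: nat.
         real w \<ge> 12 * (log 2 (real (length (encode_bpsp I))) + log 2 (real W) * log 2 (real T)) \<longrightarrow>
         (\<exists>k :: nat.
            computes_in w reduction (encode_bpsp I) (encode_oapt J) k \<and>
            real k \<le> 300 * (real N * 2 powr (16 * (log 2 (real W) * log 2 (real T))))))"
    unfolding T W
    by (intro exI[of _ target] conjI allI impI)
      (use oapt_wf_target size_target oapt_yes_target computes_target in blast)+
qed

end
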